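(* Let $\alpha$ be a nonzero real constant and let $(M,\varphi,\xi,\eta,g)$ be an $\alpha$-Kenmotsu manifold with $\dim M=2m+1\ge5$. Then there is no contact-complex Riemannian submersion $\pi:(M,\varphi,\xi,\eta,g)\to(M',J,g')$ onto an almost Hermitian manifold $(M',J,g')$ of dimension $2n\ge2$.
   Context: All objects are smooth. An almost contact metric (ACM) manifold $(M,\varphi,\xi,\eta,g)$ is a $(2m+1)$-dimensional Riemannian manifold with a $(1,1)$-tensor field $\varphi$, a vector field $\xi$ and a 1-form $\eta$ such that $\varphi^2=-I+\eta\otimes\xi$, $\eta(\xi)=1$, $g(\varphi X,\varphi Y)=g(X,Y)-\eta(X)\eta(Y)$. It is $\alpha$-Kenmotsu if $(\nabla_X\varphi)Y=\alpha\big(g(\varphi X,Y)\xi-\eta(Y)\varphi X\big)$ for all vector fields $X,Y$, where $\nabla$ is the Levi-Civita connection. An almost Hermitian manifold $(M',J,g')$ has $J^2=-I$ and $g'(JX,JY)=g'(X,Y)$. A contact-complex Riemannian submersion $\pi:(M,\varphi,\xi,\eta,g)\to(M',J,g')$ is a Riemannian submersion from an ACM manifold onto an almost Hermitian manifold with $J\circ\pi_*=\pi_*\circ\varphi$. *)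

theory Defs
  imports "HOL-Analysis.Analysis" "HOL-Library.Function_Algebras"
begin

section \<open>Smooth maps between Euclidean spaces\<close>

text \<open>Only used for open \<^term>\<open>S\<close>. In finite dimension, requiring all directional derivatives to be
  again of class \<open>C^k\<close> is the same as requiring this of the derivative as an operator-valued map.\<close>

primrec Ck_on :: "nat \<Rightarrow> 'a set \<Rightarrow> ('a::euclidean_space \<Rightarrow> 'b::real_normed_vector) \<Rightarrow> bool" where
  "Ck_on 0 S f \<longleftrightarrow> continuous_on S f"
| "Ck_on (Suc k) S f \<longleftrightarrow> (\<forall>x\<in>S. f differentiable (at x)) \<and>
     (\<forall>v. Ck_on k S (\<lambda>x. frechet_derivative f (at x) v))"

definition smooth_on :: "'a set \<Rightarrow> ('a::euclidean_space \<Rightarrow> 'b::real_normed_vector) \<Rightarrow> bool" where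
  "smooth_on S f \<longleftrightarrow> (\<forall>k. Ck_on k S f)"

section \<open>Smooth manifolds\<close>

text \<open>The points of a manifold are all the points of a second countable Hausdorff type
  (so manifolds are nonempty), and its dimension is that of the model space \<^typ>\<open>'e\<close>.
  The smooth structure is given by an atlas that need not be maximal; nothing below changes when
  it is enlarged to the maximal one.\<close>

type_synonym ('m, 'e) chart = "'m set \<times> ('m \<Rightarrow> 'e)"
type_synonym ('m, 'e) atlas = "('m, 'e) chart set"

definition is_chart :: "('m::topological_space, 'e::euclidean_space) chart \<Rightarrow> bool" where
  "is_chart = (\<lambda>(U, c). open U \<and> open (c ` U) \<and> homeomorphism U (c ` U) c (inv_into U c))"

definition smooth_manifold ::
    "('m::{second_countable_topology, t2_space}, 'e::euclidean_space) atlas \<Rightarrow> bool" where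
  "smooth_manifold A \<longleftrightarrow>
     (\<forall>k\<in>A. is_chart k) \<and>
     (\<Union>(U, c)\<in>A. U) = UNIV \<and>
     (\<forall>(U, c)\<in>A. \<forall>(V, d)\<in>A. smooth_on (c ` (U \<inter> V)) (d \<circ> inv_into U c))"

definition smooth_functions :: "('m, 'e::euclidean_space) atlas \<Rightarrow> ('m \<Rightarrow> real) set" where
  "smooth_functions A = {f. \<forall>(U, c)\<in>A. smooth_on (c ` U) (f \<circ> inv_into U c)}"

definition smooth_map ::
    "('m::topological_space, 'e::euclidean_space) atlas \<Rightarrow>
     ('n::topological_space, 'd::euclidean_space) atlas \<Rightarrow> ('m \<Rightarrow> 'n) \<Rightarrow> bool" where
  "smooth_map A B F \<longleftrightarrow> continuous_on UNIV F \<and>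
     (\<forall>(U, c)\<in>A. \<forall>(V, d)\<in>B. smooth_on (c ` (U \<inter> F -` V)) (d \<circ> F \<circ> inv_into U c))"

section \<open>Tangent vectors and tensor fields\<close>

text \<open>Tangent vectors at \<open>p\<close> are the derivations at \<open>p\<close> of the algebra of smooth functions. They are
  extended by \<open>0\<close> to non-smooth functions, so that equality of tangent vectors is equality in HOL.
  Addition, subtraction and zero of tangent vectors are the pointwise ones.\<close>

type_synonym 'm tvec = "('m \<Rightarrow> real) \<Rightarrow> real"
type_synonym 'm vfield = "'m \<Rightarrow> 'm tvec"

definition scaleT :: "real \<Rightarrow> 'm tvec \<Rightarrow> 'm tvec"  (infixr "\<odot>" 75) where
  "a \<odot> v = (\<lambda>f. a * v f)"

definition tangent_space :: "('m, 'e::euclidean_space) atlas \<Rightarrow> 'm \<Rightarrow> 'm tvec set" where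
  "tangent_space A p = {v.
     (\<forall>f\<in>smooth_functions A. \<forall>h\<in>smooth_functions A. v (\<lambda>x. f x + h x) = v f + v h) \<and>
     (\<forall>a. \<forall>f\<in>smooth_functions A. v (\<lambda>x. a * f x) = a * v f) \<and>
     (\<forall>f\<in>smooth_functions A. \<forall>h\<in>smooth_functions A.
        v (\<lambda>x. f x * h x) = f p * v h + h p * v f) \<and>
     (\<forall>f. f \<notin> smooth_functions A \<longrightarrow> v f = 0)}"

definition vector_fields :: "('m, 'e::euclidean_space) atlas \<Rightarrow> 'm vfield set" where
  "vector_fields A = {X. (\<forall>p. X p \<in> tangent_space A p) \<and>
     (\<forall>f\<in>smooth_functions A. (\<lambda>p. X p f) \<in> smooth_functions A)}"

definition one_form :: "('m, 'e::euclidean_space) atlas \<Rightarrow> ('m \<Rightarrow> 'm tvec \<Rightarrow> real) \<Rightarrow> bool" where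
  "one_form A \<eta> \<longleftrightarrow>
     (\<forall>p. \<forall>u\<in>tangent_space A p. \<forall>v\<in>tangent_space A p. \<forall>a b.
        \<eta> p (a \<odot> u + b \<odot> v) = a * \<eta> p u + b * \<eta> p v) \<and>
     (\<forall>X\<in>vector_fields A. (\<lambda>p. \<eta> p (X p)) \<in> smooth_functions A)"

definition tensor_11 :: "('m, 'e::euclidean_space) atlas \<Rightarrow> ('m \<Rightarrow> 'm tvec \<Rightarrow> 'm tvec) \<Rightarrow> bool" where
  "tensor_11 A \<phi> \<longleftrightarrow>
     (\<forall>p. \<forall>u\<in>tangent_space A p. \<phi> p u \<in> tangent_space A p) \<and>
     (\<forall>p. \<forall>u\<in>tangent_space A p. \<forall>v\<in>tangent_space A p. \<forall>a b.
        \<phi> p (a \<odot> u + b \<odot> v) = a \<odot> \<phi> p u + b \<odot> \<phi> p v) \<and>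
     (\<forall>X\<in>vector_fields A. (\<lambda>p. \<phi> p (X p)) \<in> vector_fields A)"

definition riemannian_metric ::
    "('m, 'e::euclidean_space) atlas \<Rightarrow> ('m \<Rightarrow> 'm tvec \<Rightarrow> 'm tvec \<Rightarrow> real) \<Rightarrow> bool" where
  "riemannian_metric A g \<longleftrightarrow>
     (\<forall>p. \<forall>u\<in>tangent_space A p. \<forall>v\<in>tangent_space A p. \<forall>w\<in>tangent_space A p. \<forall>a b.
        g p (a \<odot> u + b \<odot> v) w = a * g p u w + b * g p v w) \<and>
     (\<forall>p. \<forall>u\<in>tangent_space A p. \<forall>v\<in>tangent_space A p. g p u v = g p v u) \<and>
     (\<forall>p. \<forall>u\<in>tangent_space A p. u \<noteq> 0 \<longrightarrow> g p u u > 0) \<and>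
     (\<forall>X\<in>vector_fields A. \<forall>Y\<in>vector_fields A. (\<lambda>p. g p (X p) (Y p)) \<in> smooth_functions A)"

definition differential ::
    "('m, 'e::euclidean_space) atlas \<Rightarrow> ('n, 'd::euclidean_space) atlas \<Rightarrow>
     ('m \<Rightarrow> 'n) \<Rightarrow> 'm tvec \<Rightarrow> 'n tvec" where
  "differential A B F v = (\<lambda>h. if h \<in> smooth_functions B then v (h \<circ> F) else 0)"

section \<open>The Levi-Civita connection\<close>

definition lie_bracket :: "'m vfield \<Rightarrow> 'm vfield \<Rightarrow> 'm vfield" where
  "lie_bracket X Y = (\<lambda>p f. X p (\<lambda>q. Y q f) - Y p (\<lambda>q. X q f))"

definition affine_connection ::
    "('m, 'e::euclidean_space) atlas \<Rightarrow> ('m vfield \<Rightarrow> 'm vfield \<Rightarrow> 'm vfield) \<Rightarrow> bool" where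
  "affine_connection A nabla \<longleftrightarrow>
     (\<forall>X\<in>vector_fields A. \<forall>Y\<in>vector_fields A. nabla X Y \<in> vector_fields A) \<and>
     (\<forall>X\<in>vector_fields A. \<forall>Y\<in>vector_fields A. \<forall>Z\<in>vector_fields A.
        nabla (X + Y) Z = nabla X Z + nabla Y Z \<and>
        nabla X (Y + Z) = nabla X Y + nabla X Z) \<and>
     (\<forall>f\<in>smooth_functions A. \<forall>X\<in>vector_fields A. \<forall>Y\<in>vector_fields A.
        nabla (\<lambda>p. f p \<odot> X p) Y = (\<lambda>p. f p \<odot> nabla X Y p) \<and>
        nabla X (\<lambda>p. f p \<odot> Y p) = (\<lambda>p. X p f \<odot> Y p + f p \<odot> nabla X Y p))"

definition levi_civita_connection ::
    "('m, 'e::euclidean_space) atlas \<Rightarrow> ('m \<Rightarrow> 'm tvec \<Rightarrow> 'm tvec \<Rightarrow> real) \<Rightarrow>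
     ('m vfield \<Rightarrow> 'm vfield \<Rightarrow> 'm vfield) \<Rightarrow> bool" where
  "levi_civita_connection A g nabla \<longleftrightarrow>
     affine_connection A nabla \<and>
     (\<forall>X\<in>vector_fields A. \<forall>Y\<in>vector_fields A. nabla X Y - nabla Y X = lie_bracket X Y) \<and>
     (\<forall>X\<in>vector_fields A. \<forall>Y\<in>vector_fields A. \<forall>Z\<in>vector_fields A. \<forall>p.
        X p (\<lambda>q. g q (Y q) (Z q)) = g p (nabla X Y p) (Z p) + g p (Y p) (nabla X Z p))"

section \<open>Almost contact metric, Kenmotsu and almost Hermitian manifolds\<close>

definition almost_contact_metric_manifold ::
    "('m::{second_countable_topology, t2_space}, 'e::euclidean_space) atlas \<Rightarrow>
     ('m \<Rightarrow> 'm tvec \<Rightarrow> 'm tvec) \<Rightarrow> 'm vfield \<Rightarrow> ('m \<Rightarrow> 'm tvec \<Rightarrow> real) \<Rightarrow>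
     ('m \<Rightarrow> 'm tvec \<Rightarrow> 'm tvec \<Rightarrow> real) \<Rightarrow> bool" where
  "almost_contact_metric_manifold A \<phi> \<xi> \<eta> g \<longleftrightarrow>
     smooth_manifold A \<and> odd DIM('e) \<and> riemannian_metric A g \<and>
     tensor_11 A \<phi> \<and> \<xi> \<in> vector_fields A \<and> one_form A \<eta> \<and>
     (\<forall>p. \<forall>u\<in>tangent_space A p. \<phi> p (\<phi> p u) = - u + \<eta> p u \<odot> \<xi> p) \<and>
     (\<forall>p. \<eta> p (\<xi> p) = 1) \<and>
     (\<forall>p. \<forall>u\<in>tangent_space A p. \<forall>v\<in>tangent_space A p.
        g p (\<phi> p u) (\<phi> p v) = g p u v - \<eta> p u * \<eta> p v)"

text \<open>The Levi-Civita connection exists and is unique on smooth vector fields, but an operator on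
  arbitrary functions is not determined outside the vector fields, hence the existential.
  The left-hand side of the last equation is \<open>(\<nabla>\<^sub>X \<phi>) Y\<close>.\<close>

definition alpha_kenmotsu_manifold ::
    "real \<Rightarrow> ('m::{second_countable_topology, t2_space}, 'e::euclidean_space) atlas \<Rightarrow>
     ('m \<Rightarrow> 'm tvec \<Rightarrow> 'm tvec) \<Rightarrow> 'm vfield \<Rightarrow> ('m \<Rightarrow> 'm tvec \<Rightarrow> real) \<Rightarrow>
     ('m \<Rightarrow> 'm tvec \<Rightarrow> 'm tvec \<Rightarrow> real) \<Rightarrow> bool" where
  "alpha_kenmotsu_manifold \<alpha> A \<phi> \<xi> \<eta> g \<longleftrightarrow>
     almost_contact_metric_manifold A \<phi> \<xi> \<eta> g \<and>
     (\<exists>nabla. levi_civita_connection A g nabla \<and>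
       (\<forall>X\<in>vector_fields A. \<forall>Y\<in>vector_fields A. \<forall>p.
          nabla X (\<lambda>q. \<phi> q (Y q)) p - \<phi> p (nabla X Y p) =
          \<alpha> \<odot> (g p (\<phi> p (X p)) (Y p) \<odot> \<xi> p - \<eta> p (Y p) \<odot> \<phi> p (X p))))"

definition almost_hermitian_manifold ::
    "('m::{second_countable_topology, t2_space}, 'e::euclidean_space) atlas \<Rightarrow>
     ('m \<Rightarrow> 'm tvec \<Rightarrow> 'm tvec) \<Rightarrow> ('m \<Rightarrow> 'm tvec \<Rightarrow> 'm tvec \<Rightarrow> real) \<Rightarrow> bool" where
  "almost_hermitian_manifold A J g \<longleftrightarrow>
     smooth_manifold A \<and> riemannian_metric A g \<and> tensor_11 A J \<and>
     (\<forall>p. \<forall>u\<in>tangent_space A p. J p (J p u) = - u) \<and>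
     (\<forall>p. \<forall>u\<in>tangent_space A p. \<forall>v\<in>tangent_space A p. g p (J p u) (J p v) = g p u v)"

section \<open>Contact-complex Riemannian submersions\<close>

definition vertical_space ::
    "('m, 'e::euclidean_space) atlas \<Rightarrow> ('n, 'd::euclidean_space) atlas \<Rightarrow>
     ('m \<Rightarrow> 'n) \<Rightarrow> 'm \<Rightarrow> 'm tvec set" where
  "vertical_space A B \<pi> p = {v \<in> tangent_space A p. differential A B \<pi> v = 0}"

definition horizontal_space ::
    "('m, 'e::euclidean_space) atlas \<Rightarrow> ('m \<Rightarrow> 'm tvec \<Rightarrow> 'm tvec \<Rightarrow> real) \<Rightarrow>
     ('n, 'd::euclidean_space) atlas \<Rightarrow> ('m \<Rightarrow> 'n) \<Rightarrow> 'm \<Rightarrow> 'm tvec set" where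
  "horizontal_space A g B \<pi> p =
     {u \<in> tangent_space A p. \<forall>v\<in>vertical_space A B \<pi> p. g p u v = 0}"

definition riemannian_submersion ::
    "('m::topological_space, 'e::euclidean_space) atlas \<Rightarrow> ('m \<Rightarrow> 'm tvec \<Rightarrow> 'm tvec \<Rightarrow> real) \<Rightarrow>
     ('n::topological_space, 'd::euclidean_space) atlas \<Rightarrow> ('n \<Rightarrow> 'n tvec \<Rightarrow> 'n tvec \<Rightarrow> real) \<Rightarrow>
     ('m \<Rightarrow> 'n) \<Rightarrow> bool" where
  "riemannian_submersion A g B g' \<pi> \<longleftrightarrow>
     smooth_map A B \<pi> \<and> surj \<pi> \<and>
     (\<forall>p. differential A B \<pi> ` tangent_space A p = tangent_space B (\<pi> p)) \<and>
     (\<forall>p. \<forall>u\<in>horizontal_space A g B \<pi> p. \<forall>v\<in>horizontal_space A g B \<pi> p.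
        g' (\<pi> p) (differential A B \<pi> u) (differential A B \<pi> v) = g p u v)"

definition contact_complex_riemannian_submersion ::
    "('m::{second_countable_topology, t2_space}, 'e::euclidean_space) atlas \<Rightarrow>
     ('m \<Rightarrow> 'm tvec \<Rightarrow> 'm tvec) \<Rightarrow> 'm vfield \<Rightarrow> ('m \<Rightarrow> 'm tvec \<Rightarrow> real) \<Rightarrow>
     ('m \<Rightarrow> 'm tvec \<Rightarrow> 'm tvec \<Rightarrow> real) \<Rightarrow>
     ('n::{second_countable_topology, t2_space}, 'd::euclidean_space) atlas \<Rightarrow>
     ('n \<Rightarrow> 'n tvec \<Rightarrow> 'n tvec) \<Rightarrow> ('n \<Rightarrow> 'n tvec \<Rightarrow> 'n tvec \<Rightarrow> real) \<Rightarrow>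
     ('m \<Rightarrow> 'n) \<Rightarrow> bool" where
  "contact_complex_riemannian_submersion A \<phi> \<xi> \<eta> g B J g' \<pi> \<longleftrightarrow>
     almost_contact_metric_manifold A \<phi> \<xi> \<eta> g \<and>
     almost_hermitian_manifold B J g' \<and>
     riemannian_submersion A g B g' \<pi> \<and>
     (\<forall>p. \<forall>u\<in>tangent_space A p.
        J (\<pi> p) (differential A B \<pi> u) = differential A B \<pi> (\<phi> p u))"

end

theory Submission
  imports Defs
begin

text \<open>
  On an \<open>\<alpha>\<close>-Kenmotsu manifold \<open>\<nabla>\<^sub>X \<xi> = \<alpha> X\<close> for \<open>X\<close> orthogonal to \<open>\<xi>\<close>, so the metric on the orthogonal
  complement of \<open>\<xi>\<close> is stretched at rate \<open>2 \<alpha>\<close> along \<open>\<xi>\<close> (\<open>kenmotsu_nabla_xi\<close>). For a contact-complex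
  Riemannian submersion \<open>\<pi>\<close>, however, \<open>J (d\<pi> \<xi>) = d\<pi> (\<phi> \<xi>) = 0\<close>, so \<open>\<xi>\<close> is tangent to the fibres, and
  the metric on horizontal vectors is pulled back from the base, so it cannot change along the fibres.
  The base has positive dimension, hence there are nonzero horizontal vectors, and \<open>\<alpha> = 0\<close>.

  The usual way to make this precise uses basic vector fields, whose construction rests on the local
  normal form of submersions. That is avoided by a minimum argument. Let \<open>X\<close> be any vector field on
  \<open>M\<close> whose value at one point \<open>p\<close> is horizontal and nonzero. The function
  \<open>F = g(X, X) - g'(d\<pi> X, d\<pi> X)\<close> is nonnegative, because \<open>d\<pi>\<close> does not increase lengths
  (\<open>g_contracts\<close>), and it vanishes at \<open>p\<close>; so \<open>\<xi> F = 0\<close> at \<open>p\<close>. Put \<open>Z = [\<xi>, X]\<close>. At \<open>p\<close> the first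
  term contributes \<open>2 g(\<nabla>\<^sub>\<xi> X, X) = 2 g(Z, X) + 2 g(\<nabla>\<^sub>X \<xi>, X) = 2 g(Z, X) + 2 \<alpha> g(X, X)\<close>. For the
  second, \<open>\<xi>\<close> kills all functions \<open>k \<circ> \<pi>\<close>, whence \<open>\<xi> (X (k \<circ> \<pi>)) = Z (k \<circ> \<pi>)\<close>. In coordinates \<open>k\<^sub>i\<close> of the
  base the coefficients of \<open>d\<pi> X\<close> are the functions \<open>X (k\<^sub>i \<circ> \<pi>)\<close> and those of \<open>g'\<close> are pulled back, so the
  second term contributes \<open>2 g'(d\<pi> Z, d\<pi> X)\<close>, which is \<open>2 g(Z, X)\<close> (\<open>g_horizontal\<close>). The difference is
  \<open>2 \<alpha> g(X, X) = 0\<close>, a contradiction.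

  Tangent vectors being derivations of the algebra of global smooth functions, the work lies in showing
  that they are combinations of coordinate derivatives. This is \<open>local_frame\<close>, obtained from bump
  functions and Hadamard's lemma. It makes tangent spaces finite-dimensional, which is needed to
  split vectors into horizontal and vertical parts (\<open>horizontal_part\<close>), extends tangent vectors to vector
  fields (\<open>tangent_extend\<close>), gives the coordinate expression of \<open>F\<close>, and shows that a derivation
  vanishes on a function with a local minimum.
\<close>

section \<open>Calculus of smooth maps\<close>

lemma Ck_on_cong:
  assumes "open S" "\<And>x. x \<in> S \<Longrightarrow> f x = g x" "Ck_on k S f"
  shows "Ck_on k S g"
  using assms(2,3)
proof (induction k arbitrary: f g)
  case 0
  then show ?case by (metis Ck_on.simps(1) continuous_on_cong)
next
  case (Suc k)
  have d: "(g has_derivative frechet_derivative f (at x)) (at x)" if "x \<in> S" for x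
  proof -
    have "(f has_derivative frechet_derivative f (at x)) (at x)"
      using Suc.prems that frechet_derivative_works by auto
    then show ?thesis
      using has_derivative_transform_within_open[OF _ assms(1) that] Suc.prems(1) by blast
  qed
  have "Ck_on k S (\<lambda>x. frechet_derivative g (at x) v)" for v
    using Suc.IH[of "\<lambda>x. frechet_derivative f (at x) v" "\<lambda>x. frechet_derivative g (at x) v"]
      Suc.prems(2) d frechet_derivative_at by fastforce
  then show ?case using d by (auto simp: differentiable_def)
qed

text \<open>The definition of \<^const>\<open>Ck_on\<close> speaks of the chosen \<^const>\<open>frechet_derivative\<close>; on an
  open set any explicit formula for the derivative serves instead, which is what makes the
  inductions on the order below go through.\<close>

lemma Ck_on_SucI:
  assumes "open S" "\<And>x. x \<in> S \<Longrightarrow> (f has_derivative f' x) (at x)"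
    and "\<And>v. Ck_on k S (\<lambda>x. f' x v)"
  shows "Ck_on (Suc k) S f"
proof -
  have "Ck_on k S (\<lambda>x. frechet_derivative f (at x) v)" for v
    by (rule Ck_on_cong[OF assms(1) _ assms(3)[of v]])
      (simp add: frechet_derivative_at[OF assms(2), symmetric])
  then show ?thesis using assms(2) by (auto simp: differentiable_def)
qed

lemma Ck_on_SucD:
  assumes "Ck_on (Suc k) S f"
  shows "\<And>x. x \<in> S \<Longrightarrow> (f has_derivative frechet_derivative f (at x)) (at x)"
    and "\<And>v. Ck_on k S (\<lambda>x. frechet_derivative f (at x) v)"
  using assms frechet_derivative_works by auto

lemma Ck_on_Suc_imp: "Ck_on (Suc k) S f \<Longrightarrow> Ck_on k S f"
proof (induction k arbitrary: f)
  case 0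
  then show ?case
    by (auto intro!: continuous_at_imp_continuous_on differentiable_imp_continuous_within)
next
  case (Suc k)
  then show ?case by (metis Ck_on.simps(2))
qed

lemma Ck_on_subset: "T \<subseteq> S \<Longrightarrow> Ck_on k S f \<Longrightarrow> Ck_on k T f"
  by (induction k arbitrary: f) (auto intro: continuous_on_subset)

lemma Ck_on_local:
  assumes "\<And>x. x \<in> S \<Longrightarrow> \<exists>T. open T \<and> x \<in> T \<and> Ck_on k T f"
  shows "Ck_on k S f"
  using assms
proof (induction k arbitrary: f)
  case 0
  then show ?case
    by (auto intro!: continuous_at_imp_continuous_on simp: continuous_on_eq_continuous_at)
      (metis continuous_on_eq_continuous_at)
next
  case (Suc k)
  have "f differentiable (at x)" if "x \<in> S" for x
    using Suc.prems[OF that] by auto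
  moreover have "Ck_on k S (\<lambda>x. frechet_derivative f (at x) v)" for v
    by (rule Suc.IH) (use Suc.prems in fastforce)
  ultimately show ?case by auto
qed

lemma Ck_on_const: "Ck_on k S (\<lambda>x. c)"
proof (induction k arbitrary: c)
  case (Suc k)
  show ?case
    unfolding Ck_on.simps frechet_derivative_const using Suc.IH[of 0] differentiable_const by blast
qed simp

lemma Ck_on_bounded_linear: "bounded_linear L \<Longrightarrow> Ck_on k S L"
proof (cases k)
  case 0
  then show "bounded_linear L \<Longrightarrow> ?thesis" by (simp add: linear_continuous_on)
next
  case (Suc j)
  then show "bounded_linear L \<Longrightarrow> ?thesis"
    by (auto simp: bounded_linear_imp_differentiable Ck_on_const
        frechet_derivative_at[OF bounded_linear_imp_has_derivative, symmetric])
qed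

lemma Ck_on_add:
  assumes "open S" "Ck_on k S f" "Ck_on k S g"
  shows "Ck_on k S (\<lambda>x. f x + g x)"
  using assms(2,3)
proof (induction k arbitrary: f g)
  case 0
  then show ?case by (auto intro: continuous_intros)
next
  case (Suc k)
  show ?case
  proof (rule Ck_on_SucI[OF assms(1)])
    show "((\<lambda>x. f x + g x) has_derivative
        (\<lambda>v. frechet_derivative f (at x) v + frechet_derivative g (at x) v)) (at x)" if "x \<in> S" for x
      using Ck_on_SucD(1)[OF Suc.prems(1) that] Ck_on_SucD(1)[OF Suc.prems(2) that]
      by (rule has_derivative_add)
    show "Ck_on k S (\<lambda>x. frechet_derivative f (at x) v + frechet_derivative g (at x) v)" for v
      by (intro Suc.IH Ck_on_SucD(2) Suc.prems)
  qed
qed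

lemma Ck_on_sum:
  assumes "open S" "\<And>i. i \<in> I \<Longrightarrow> Ck_on k S (f i)"
  shows "Ck_on k S (\<lambda>x. \<Sum>i\<in>I. f i x)"
  using assms(2)
proof (induction I rule: infinite_finite_induct)
  case (insert i I)
  have "Ck_on k S (\<lambda>x. f i x + (\<Sum>i\<in>I. f i x))"
    by (rule Ck_on_add[OF assms(1)]) (use insert in auto)
  then show ?case using insert.hyps by simp
qed (simp_all add: Ck_on_const)

lemma Ck_on_bilinear:
  assumes "open S" "bounded_bilinear B" "Ck_on k S f" "Ck_on k S g"
  shows "Ck_on k S (\<lambda>x. B (f x) (g x))"
  using assms(3,4)
proof (induction k arbitrary: f g)
  case 0
  then show ?case using bounded_bilinear.continuous_on[OF assms(2)] by auto
next
  case (Suc k)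
  note fg = Suc.prems[THEN Ck_on_Suc_imp]
  show ?case
  proof (rule Ck_on_SucI[OF assms(1)])
    show "((\<lambda>x. B (f x) (g x)) has_derivative
        (\<lambda>v. B (f x) (frechet_derivative g (at x) v) + B (frechet_derivative f (at x) v) (g x))) (at x)"
      if "x \<in> S" for x
      using Ck_on_SucD(1)[OF Suc.prems(1) that] Ck_on_SucD(1)[OF Suc.prems(2) that]
      by (rule bounded_bilinear.FDERIV[OF assms(2)])
    show "Ck_on k S (\<lambda>x. B (f x) (frechet_derivative g (at x) v) +
      B (frechet_derivative f (at x) v) (g x))" for v
      by (intro Ck_on_add[OF assms(1)] Suc.IH fg Ck_on_SucD(2) Suc.prems)
  qed
qed

text \<open>By the chain rule the derivative of \<open>g \<circ> f\<close> in direction \<open>v\<close> is \<open>Dg(f x)(Df(x) v)\<close>, in which \<open>x\<close>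
  occurs in the direction argument too. Expanding \<open>Df(x) v\<close> in the basis turns it into a sum of
  products to which the induction hypothesis applies.\<close>

lemma Ck_on_compose:
  fixes f :: "'a::euclidean_space \<Rightarrow> 'b::euclidean_space"
  assumes "open S" "f ` S \<subseteq> T" "Ck_on k T g" "Ck_on k S f"
  shows "Ck_on k S (\<lambda>x. g (f x))"
  using assms(3,4)
proof (induction k arbitrary: g)
  case 0
  then show ?case using assms(2) continuous_on_compose2 by auto
next
  case (Suc k)
  have fT: "f x \<in> T" if "x \<in> S" for x using assms(2) that by blast
  let ?f' = "\<lambda>x. frechet_derivative f (at x)" and ?g' = "\<lambda>x. frechet_derivative g (at x)"
  have D: "((\<lambda>x. g (f x)) has_derivative (\<lambda>v. ?g' (f x) (?f' x v))) (at x)" if "x \<in> S" for x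
    using diff_chain_at[OF Ck_on_SucD(1)[OF Suc.prems(2) that] Ck_on_SucD(1)[OF Suc.prems(1) fT[OF that]]]
    by (simp add: o_def)
  have E: "?g' (f x) (?f' x v) = (\<Sum>b\<in>Basis. (?f' x v \<bullet> b) *\<^sub>R ?g' (f x) b)"
    if "x \<in> S" for x v
  proof -
    have l: "linear (?g' (f x))"
      using Ck_on_SucD(1)[OF Suc.prems(1) fT[OF that]] has_derivative_linear by blast
    show ?thesis
      by (subst euclidean_representation[of "?f' x v", symmetric])
        (simp add: linear_sum[OF l] linear_cmul[OF l] o_def)
  qed
  have "((\<lambda>x. g (f x)) has_derivative
      (\<lambda>v. \<Sum>b\<in>Basis. (?f' x v \<bullet> b) *\<^sub>R ?g' (f x) b)) (at x)" if "x \<in> S" for x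
    using D[OF that] by (simp add: E[OF that])
  then show ?case
  proof (rule Ck_on_SucI[OF assms(1)])
    fix v
    have "Ck_on k S f" using Suc.prems(2) by (rule Ck_on_Suc_imp)
    then have "Ck_on k S (\<lambda>x. ?g' (f x) b)" for b
      by (intro Suc.IH) (use Suc.prems in auto)
    moreover have "Ck_on k S (\<lambda>x. ?f' x v \<bullet> b)" for b
      using Suc.prems(2)
      by (intro Ck_on_bilinear[OF assms(1) bounded_bilinear_inner] Ck_on_const) auto
    ultimately show "Ck_on k S (\<lambda>x. \<Sum>b\<in>Basis. (?f' x v \<bullet> b) *\<^sub>R ?g' (f x) b)"
      by (intro Ck_on_sum Ck_on_bilinear[OF assms(1) bounded_bilinear_scaleR] assms(1))
  qed
qed

lemma smooth_on_cong:
  "open S \<Longrightarrow> (\<And>x. x \<in> S \<Longrightarrow> f x = g x) \<Longrightarrow> smooth_on S f \<Longrightarrow> smooth_on S g"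
  unfolding smooth_on_def using Ck_on_cong by metis

lemma smooth_on_subset: "T \<subseteq> S \<Longrightarrow> smooth_on S f \<Longrightarrow> smooth_on T f"
  unfolding smooth_on_def using Ck_on_subset by blast

lemma smooth_on_local:
  "(\<And>x. x \<in> S \<Longrightarrow> \<exists>T. open T \<and> x \<in> T \<and> smooth_on T f) \<Longrightarrow> smooth_on S f"
  unfolding smooth_on_def by (metis Ck_on_local)

lemma smooth_on_const: "smooth_on S (\<lambda>x. c)"
  by (simp add: smooth_on_def Ck_on_const)

lemma smooth_on_bounded_linear: "bounded_linear L \<Longrightarrow> smooth_on S L"
  by (simp add: smooth_on_def Ck_on_bounded_linear)

lemma smooth_on_add:
  "open S \<Longrightarrow> smooth_on S f \<Longrightarrow> smooth_on S g \<Longrightarrow> smooth_on S (\<lambda>x. f x + g x)"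
  by (simp add: smooth_on_def Ck_on_add)

lemma smooth_on_bilinear:
  "open S \<Longrightarrow> bounded_bilinear B \<Longrightarrow> smooth_on S f \<Longrightarrow> smooth_on S g \<Longrightarrow>
    smooth_on S (\<lambda>x. B (f x) (g x))"
  by (simp add: smooth_on_def Ck_on_bilinear)

lemmas smooth_on_mult = smooth_on_bilinear[OF _ bounded_bilinear_mult]

lemma smooth_on_compose:
  fixes f :: "'a::euclidean_space \<Rightarrow> 'b::euclidean_space"
  shows "open S \<Longrightarrow> f ` S \<subseteq> T \<Longrightarrow> smooth_on T g \<Longrightarrow> smooth_on S f \<Longrightarrow> smooth_on S (\<lambda>x. g (f x))"
  unfolding smooth_on_def using Ck_on_compose by blast

lemma smooth_on_frechet_derivative:
  "smooth_on S f \<Longrightarrow> smooth_on S (\<lambda>x. frechet_derivative f (at x) v)"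
  unfolding smooth_on_def by (metis Ck_on.simps(2))

lemma smooth_on_imp_has_derivative:
  "smooth_on S f \<Longrightarrow> x \<in> S \<Longrightarrow> (f has_derivative frechet_derivative f (at x)) (at x)"
  unfolding smooth_on_def using Ck_on_SucD(1) by blast

lemma smooth_on_imp_continuous_on: "smooth_on S f \<Longrightarrow> continuous_on S f"
  unfolding smooth_on_def by (metis Ck_on.simps(1))

section \<open>A flat function and bump functions\<close>

text \<open>For \<open>n = 0\<close> this is the classical smooth function that is not analytic at \<open>0\<close>. The factor
  \<open>inverse t ^ n\<close> makes the family closed under differentiation, so one induction gives smoothness.\<close>

definition flat :: "nat \<Rightarrow> real \<Rightarrow> real" where
  "flat n t = (if t > 0 then inverse t ^ n * exp (- inverse t) else 0)"

lemma flat_tendsto_0: "(flat n \<longlongrightarrow> 0) (at_right 0)"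
proof -
  have "((\<lambda>t::real. inverse t ^ n / exp (inverse t)) \<longlongrightarrow> 0) (at_right 0)"
    by (rule filterlim_compose[OF tendsto_power_div_exp_0 filterlim_inverse_at_top_right])
  moreover have "\<forall>\<^sub>F t in at_right 0. inverse t ^ n / exp (inverse t) = flat n t"
    by (auto simp: eventually_at_filter flat_def exp_minus divide_simps)
  ultimately show ?thesis using tendsto_cong by force
qed

lemma flat_DERIV:
  "(flat n has_real_derivative (flat (n + 2) t - real n * flat (n + 1) t)) (at t)"
proof -
  consider "t > 0" | "t < 0" | "t = 0" by linarith
  then show ?thesis
  proof cases
    case 1
    have key: "inverse t * inverse t ^ (k - Suc 0) = inverse t ^ k" if "k \<noteq> 0" for k
      using that by (cases k) auto
    have "((\<lambda>t. inverse t ^ n * exp (- inverse t)) has_real_derivative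
        (flat (n + 2) t - real n * flat (n + 1) t)) (at t)"
      using 1 by (cases n; auto intro!: derivative_eq_intros simp: flat_def algebra_simps)
        (metis key)
    then show ?thesis
      by (rule has_field_derivative_transform_within_open[where S="{0<..}"]) (use 1 in \<open>auto simp: flat_def\<close>)
  next
    case 2
    have "((\<lambda>t. 0) has_real_derivative (flat (n + 2) t - real n * flat (n + 1) t)) (at t)"
      using 2 by (auto simp: flat_def)
    then show ?thesis
      by (rule has_field_derivative_transform_within_open[where S="{..<0}"]) (use 2 in \<open>auto simp: flat_def\<close>)
  next
    case 3
    \<comment> \<open>The difference quotient at \<open>0\<close> is \<open>flat (n + 1)\<close> on the right and \<open>0\<close> on the left.\<close>
    have "((\<lambda>y. (flat n y - flat n 0) / (y - 0)) \<longlongrightarrow> 0) (at 0)"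
      unfolding filterlim_at_split
    proof
      show "((\<lambda>y. (flat n y - flat n 0) / (y - 0)) \<longlongrightarrow> 0) (at_left 0)"
        by (rule tendsto_eventually) (auto simp: flat_def eventually_at_filter)
      have "\<forall>\<^sub>F y in at_right 0. flat (Suc n) y = (flat n y - flat n 0) / (y - 0)"
        by (auto simp: flat_def eventually_at_filter field_simps)
      then show "((\<lambda>y. (flat n y - flat n 0) / (y - 0)) \<longlongrightarrow> 0) (at_right 0)"
        using flat_tendsto_0[of "Suc n"] tendsto_cong by force
    qed
    then show ?thesis using 3 by (simp add: has_field_derivative_iff flat_def)
  qed
qed

lemma flat_smooth: "smooth_on UNIV (flat n)"
proof -
  have "Ck_on k UNIV (flat n)" for k
  proof (induction k arbitrary: n)
    case 0
    then show ?case by (auto intro!: continuous_at_imp_continuous_on DERIV_isCont flat_DERIV)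
  next
    case (Suc k)
    have d: "(flat n has_derivative (\<lambda>v. v * (flat (n + 2) t + (- real n) * flat (n + 1) t))) (at t)" for t
      using flat_DERIV[of n t] by (simp add: has_field_derivative_def mult_commute_abs)
    show ?case
      by (rule Ck_on_SucI[OF open_UNIV d])
        (intro Ck_on_bilinear[OF open_UNIV bounded_bilinear_mult] Ck_on_add[OF open_UNIV] Ck_on_const Suc)
  qed
  then show ?thesis by (simp add: smooth_on_def)
qed

text \<open>Composing the flat function \<open>f\<close> with itself avoids the usual quotient: \<open>u\<close> is \<open>\<le> 0\<close> near \<open>a\<close> and
  \<open>\<ge> 1\<close> far away, hence \<open>1 - e f(u)\<close> is \<open>1\<close> near \<open>a\<close> and \<open>\<le> 0\<close> far away, as \<open>f(1) = 1/e\<close>; applying \<open>e f\<close>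
  once more gives \<open>1\<close> and \<open>0\<close>.\<close>

lemma bump_exists:
  fixes a :: "'e::euclidean_space"
  assumes "r > 0"
  obtains \<beta> :: "'e \<Rightarrow> real" and s where "smooth_on UNIV \<beta>" "0 < s"
    "\<And>x. x \<in> ball a s \<Longrightarrow> \<beta> x = 1" "\<And>x. x \<notin> cball a r \<Longrightarrow> \<beta> x = 0"
proof -
  define s where "s = r / 2"
  define u where "u = (\<lambda>x::'e. ((x - a) \<bullet> (x - a) + (- (s\<^sup>2))) * (1 / s\<^sup>2))"
  define \<beta> where "\<beta> = (\<lambda>x. exp 1 * flat 0 (1 + (- exp 1) * flat 0 (u x)))"
  have s: "s > 0" using assms s_def by simp
  have "smooth_on UNIV (\<lambda>x::'e. x + (- a))"
    by (intro smooth_on_add smooth_on_const smooth_on_bounded_linear bounded_linear_ident open_UNIV)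
  then have sm: "smooth_on UNIV (\<lambda>x::'e. x - a)" by simp
  have "smooth_on UNIV u" unfolding u_def
    by (intro smooth_on_mult smooth_on_add smooth_on_bilinear[OF _ bounded_bilinear_inner] sm
        smooth_on_const open_UNIV)
  then have "smooth_on UNIV \<beta>" unfolding \<beta>_def
    by (intro smooth_on_mult smooth_on_add smooth_on_const open_UNIV
        smooth_on_compose[OF open_UNIV _ flat_smooth]) auto
  moreover have "\<beta> x = 1" if "x \<in> ball a s" for x
  proof -
    have "(norm (x - a))\<^sup>2 \<le> s\<^sup>2"
      using that by (intro power_mono) (auto simp: dist_norm norm_minus_commute)
    then have "u x \<le> 0" using s by (simp add: u_def dot_square_norm divide_simps)
    then show ?thesis by (simp add: \<beta>_def flat_def flip: exp_add)
  qed
  moreover have "\<beta> x = 0" if "x \<notin> cball a r" for x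
  proof -
    have "(2 * s)\<^sup>2 \<le> (norm (x - a))\<^sup>2"
      using that s by (intro power_mono) (auto simp: dist_norm norm_minus_commute s_def)
    then have "(x - a) \<bullet> (x - a) \<ge> 4 * s\<^sup>2" by (simp add: dot_square_norm)
    moreover have "s\<^sup>2 > 0" using s by simp
    ultimately have "(x - a) \<bullet> (x - a) \<ge> 2 * s\<^sup>2" by linarith
    then have "u x \<ge> 1" using s by (simp add: u_def divide_simps)
    then have "flat 0 (u x) \<ge> exp (- 1)"
      by (auto simp: flat_def field_simps)
    then have "exp 1 * flat 0 (u x) \<ge> exp 1 * exp (- 1)" by (intro mult_left_mono) auto
    then show ?thesis by (simp add: \<beta>_def flat_def flip: exp_add)
  qed
  ultimately show thesis using that s by blast
qed

section \<open>Hadamard's lemma\<close>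

text \<open>Differentiating under the integral sign multiplies the weight \<open>\<phi>\<close> by \<open>t\<close> and replaces \<open>F\<close> by one of
  its directional derivatives, so the family of all such integrals is closed under differentiation;
  this is why a weight is carried along.\<close>

lemma Ck_on_ray_integral:
  fixes F :: "'e::euclidean_space \<Rightarrow> real" and \<phi> :: "real \<Rightarrow> real"
  assumes S: "S = ball a r" and "Ck_on k S F" "continuous_on {0..1} \<phi>"
  shows "Ck_on k S (\<lambda>x. integral {0..1} (\<lambda>t. \<phi> t * F (a + t *\<^sub>R (x - a))))"
  using assms(2,3)
proof (induction k arbitrary: F \<phi>)
  have mem: "a + t *\<^sub>R (x - a) \<in> S" if "x \<in> S" "t \<in> {0..1}" for x t
  proof -
    have "norm (t *\<^sub>R (x - a)) \<le> 1 * norm (x - a)"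
      using that by (auto intro: mult_left_le_one_le)
    then show ?thesis using that by (auto simp: S dist_norm norm_minus_commute)
  qed
  have cont: "continuous_on (S \<times> {0..1}) (\<lambda>(x, t). \<phi> t * F (a + t *\<^sub>R (x - a)))"
    if "continuous_on S F" "continuous_on {0..1} \<phi>" for F :: "'e \<Rightarrow> real" and \<phi> :: "real \<Rightarrow> real"
    unfolding split_beta
    by (intro continuous_intros continuous_on_compose2[OF that(1)] continuous_on_compose2[OF that(2)])
      (use mem in auto)
  {
    case 0
    then have c: "continuous_on (S \<times> cbox 0 1) (\<lambda>(x, t). \<phi> t * F (a + t *\<^sub>R (x - a)))"
      using cont by auto
    show ?case
      using integral_continuous_on_param[OF c] by simp
  next
    case (Suc k)
    let ?F' = "\<lambda>x v. frechet_derivative F (at x) v"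
    define fx where "fx = (\<lambda>x t. Blinfun (\<lambda>v. (\<phi> t * t) * ?F' (a + t *\<^sub>R (x - a)) v))"
    have D: "((\<lambda>x. \<phi> t * F (a + t *\<^sub>R (x - a))) has_derivative
        (\<lambda>v. (\<phi> t * t) * ?F' (a + t *\<^sub>R (x - a)) v)) (at x)" if "x \<in> S" "t \<in> {0..1}" for x t
    proof -
      have F: "(F has_derivative ?F' (a + t *\<^sub>R (x - a))) (at (a + t *\<^sub>R (x - a)))"
        using Ck_on_SucD(1)[OF Suc.prems(1)] mem that by blast
      have "((\<lambda>x. F (a + t *\<^sub>R (x - a))) has_derivative
          (\<lambda>v. ?F' (a + t *\<^sub>R (x - a)) (t *\<^sub>R v))) (at x)"
        by (rule has_derivative_compose[where f="\<lambda>x. a + t *\<^sub>R (x - a)", OF _ F]) (auto intro!: derivative_eq_intros)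
      from has_derivative_mult_right[OF this, of "\<phi> t"] show ?thesis
        by (simp add: linear_cmul[OF has_derivative_linear[OF F]] mult.assoc)
    qed
    have fx: "blinfun_apply (fx x t) v = (\<phi> t * t) * ?F' (a + t *\<^sub>R (x - a)) v"
      if "x \<in> S" "t \<in> {0..1}" for x t v
      unfolding fx_def
      using bounded_linear_Blinfun_apply[OF has_derivative_bounded_linear[OF D[OF that]]] by simp
    have phi: "continuous_on {0..1} (\<lambda>t. \<phi> t * t)" using Suc.prems(2) by (intro continuous_intros)
    have C0: "continuous_on S (\<lambda>x. ?F' x v)" for v
    proof -
      have "Ck_on 0 S (\<lambda>x. ?F' x v)" if "Ck_on k S (\<lambda>x. ?F' x v)"
        using that by (induction k) (use Ck_on_Suc_imp in blast)+
      then show ?thesis using Suc.prems(1) by auto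
    qed
    have cfx: "continuous_on (S \<times> cbox 0 1) (\<lambda>(x, t). fx x t)"
    proof (rule continuous_on_blinfun_componentwise)
      fix i :: 'e
      show "continuous_on (S \<times> cbox 0 1) (\<lambda>x. blinfun_apply (case x of (x, t) \<Rightarrow> fx x t) i)"
        unfolding box_real using cont[OF C0[of i] phi]
        by (rule continuous_on_eq) (auto simp: fx)
    qed
    have FC: "continuous_on S F" using Suc.prems(1) Ck_on_SucD(1)
      by (metis continuous_at_imp_continuous_on has_derivative_continuous)
    have int: "(\<lambda>t. \<phi> t * F (a + t *\<^sub>R (x - a))) integrable_on cbox 0 1" if "x \<in> S" for x
    proof -
      have "continuous_on {0..1} (\<lambda>t. (\<lambda>(x, t). \<phi> t * F (a + t *\<^sub>R (x - a))) (x, t))"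
        by (rule continuous_on_compose2[OF cont[OF FC Suc.prems(2)]])
          (use that in \<open>auto intro!: continuous_intros\<close>)
      then show ?thesis by (auto intro: integrable_continuous_real)
    qed
    have L: "((\<lambda>x. integral (cbox 0 1) (\<lambda>t. \<phi> t * F (a + t *\<^sub>R (x - a)))) has_derivative
        blinfun_apply (integral (cbox 0 1) (fx x))) (at x within S)" if "x \<in> S" for x
    proof (rule leibniz_rule[OF _ int cfx that])
      show "((\<lambda>x. \<phi> t * F (a + t *\<^sub>R (x - a))) has_derivative blinfun_apply (fx x t)) (at x within S)"
        if "x \<in> S" "t \<in> cbox 0 1" for x t
      proof -
        have "blinfun_apply (fx x t) = (\<lambda>v. (\<phi> t * t) * ?F' (a + t *\<^sub>R (x - a)) v)"
          using fx that by auto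
        then show ?thesis using has_derivative_at_withinI[OF D] that by simp
      qed
      show "convex S" by (simp add: S)
    qed
    show ?case
    proof (rule Ck_on_SucI)
      show "open S" by (simp add: S)
      show "((\<lambda>x. integral {0..1} (\<lambda>t. \<phi> t * F (a + t *\<^sub>R (x - a)))) has_derivative
        blinfun_apply (integral {0..1} (fx x))) (at x)" if "x \<in> S" for x
        using L[OF that] at_within_open[OF that] by (simp add: S)
      fix v
      have "blinfun_apply (integral {0..1} (fx x)) v =
          integral {0..1} (\<lambda>t. (\<phi> t * t) * ?F' (a + t *\<^sub>R (x - a)) v)" if "x \<in> S" for x
      proof -
        have "continuous_on {0..1} (\<lambda>t. (\<lambda>(x, t). fx x t) (x, t))"
          by (rule continuous_on_compose2[OF cfx]) (use that in \<open>auto intro!: continuous_intros\<close>)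
        then have "fx x integrable_on {0..1}" by (auto intro: integrable_continuous_real)
        then have "blinfun_apply (integral {0..1} (fx x)) v = integral {0..1} (\<lambda>t. blinfun_apply (fx x t) v)"
          using integral_linear[of "fx x" "{0..1}" "\<lambda>B. blinfun_apply B v"]
          by (simp add: o_def bounded_linear_blinfun_apply blinfun.bounded_linear_left)
        also have "\<dots> = integral {0..1} (\<lambda>t. (\<phi> t * t) * ?F' (a + t *\<^sub>R (x - a)) v)"
          using fx[OF that] by (intro integral_cong)
        finally show ?thesis .
      qed
      note eq = this
      show "Ck_on k S (\<lambda>x. blinfun_apply (integral {0..1} (fx x)) v)"
        by (rule Ck_on_cong[OF _ _ Suc.IH[OF Ck_on_SucD(2)[OF Suc.prems(1), of v] phi]])
          (simp_all add: eq S)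
    qed
  }
qed

text \<open>Integrate \<open>d/dt F(a + t (x - a))\<close> from \<open>0\<close> to \<open>1\<close>. This is the reason why a derivation at \<open>a\<close> sees
  nothing but the first partial derivatives at \<open>a\<close>.\<close>

lemma Hadamard:
  fixes F :: "'e::euclidean_space \<Rightarrow> real"
  assumes "smooth_on (ball a r) F" "r > 0"
  obtains G where "\<And>i. smooth_on (ball a r) (G i)"
    "\<And>x. x \<in> ball a r \<Longrightarrow> F x = F a + (\<Sum>i\<in>Basis. ((x - a) \<bullet> i) * G i x)"
    "\<And>i. i \<in> Basis \<Longrightarrow> G i a = frechet_derivative F (at a) i"
proof -
  let ?F' = "\<lambda>x v. frechet_derivative F (at x) v"
  define G where "G = (\<lambda>i x. integral {0..1} (\<lambda>t. 1 * ?F' (a + t *\<^sub>R (x - a)) i))"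
  have sm: "smooth_on (ball a r) (G i)" for i
    using smooth_on_frechet_derivative[OF assms(1), of i] unfolding G_def smooth_on_def
    by (intro allI Ck_on_ray_integral) auto
  have ex: "F x = F a + (\<Sum>i\<in>Basis. ((x - a) \<bullet> i) * G i x)" if x: "x \<in> ball a r" for x
  proof -
    have mem: "a + t *\<^sub>R (x - a) \<in> ball a r" if "t \<in> {0..1}" for t
    proof -
      have "norm (t *\<^sub>R (x - a)) \<le> 1 * norm (x - a)"
        using that by (auto intro: mult_left_le_one_le)
      then show ?thesis using x by (auto simp: dist_norm norm_minus_commute)
    qed
    have F: "(F has_derivative ?F' (a + t *\<^sub>R (x - a))) (at (a + t *\<^sub>R (x - a)))" if "t \<in> {0..1}" for t
      using smooth_on_imp_has_derivative[OF assms(1) mem[OF that]] .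
    have "((\<lambda>t. F (a + t *\<^sub>R (x - a))) has_vector_derivative ?F' (a + t *\<^sub>R (x - a)) (x - a))
        (at t within {0..1})" if "t \<in> {0..1}" for t
    proof -
      have "((\<lambda>t. F (a + t *\<^sub>R (x - a))) has_derivative
          (\<lambda>s. ?F' (a + t *\<^sub>R (x - a)) (s *\<^sub>R (x - a)))) (at t within {0..1})"
        by (rule has_derivative_compose[where f="\<lambda>t. a + t *\<^sub>R (x - a)", OF _ F[OF that]]) (auto intro!: derivative_eq_intros)
      then show ?thesis
        by (simp add: has_vector_derivative_def linear_cmul[OF has_derivative_linear[OF F[OF that]]])
    qed
    then have "((\<lambda>t. ?F' (a + t *\<^sub>R (x - a)) (x - a)) has_integral F (a + 1 *\<^sub>R (x - a)) - F (a + 0 *\<^sub>R (x - a))) {0..1}"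
      by (intro fundamental_theorem_of_calculus) auto
    then have I: "((\<lambda>t. ?F' (a + t *\<^sub>R (x - a)) (x - a)) has_integral (F x - F a)) {0..1}" by simp
    have "((\<lambda>t. \<Sum>i\<in>Basis. ((x - a) \<bullet> i) * (1 * ?F' (a + t *\<^sub>R (x - a)) i)) has_integral
        (\<Sum>i\<in>Basis. ((x - a) \<bullet> i) * G i x)) {0..1}"
    proof (intro has_integral_sum finite_Basis has_integral_mult_right)
      fix i :: 'e
      have "continuous_on {0..1} (\<lambda>t. 1 * ?F' (a + t *\<^sub>R (x - a)) i)"
        by (intro continuous_intros continuous_on_compose2[OF
              smooth_on_imp_continuous_on[OF smooth_on_frechet_derivative[OF assms(1), of i]]])
          (use mem in auto)
      then show "((\<lambda>t. 1 * ?F' (a + t *\<^sub>R (x - a)) i) has_integral G i x) {0..1}"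
        unfolding G_def by (intro integrable_integral integrable_continuous_real)
    qed
    moreover have "(\<Sum>i\<in>Basis. ((x - a) \<bullet> i) * (1 * ?F' (a + t *\<^sub>R (x - a)) i)) =
        ?F' (a + t *\<^sub>R (x - a)) (x - a)" if "t \<in> {0..1}" for t
    proof -
      note l = has_derivative_linear[OF F[OF that]]
      have "?F' (a + t *\<^sub>R (x - a)) (x - a) =
          ?F' (a + t *\<^sub>R (x - a)) (\<Sum>i\<in>Basis. ((x - a) \<bullet> i) *\<^sub>R i)"
        by (simp only: euclidean_representation)
      also have "\<dots> = (\<Sum>i\<in>Basis. ((x - a) \<bullet> i) * (1 * ?F' (a + t *\<^sub>R (x - a)) i))"
        by (simp add: linear_sum[OF l] linear_cmul[OF l] o_def)
      finally show ?thesis by simp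
    qed
    ultimately have "((\<lambda>t. ?F' (a + t *\<^sub>R (x - a)) (x - a)) has_integral
        (\<Sum>i\<in>Basis. ((x - a) \<bullet> i) * G i x)) {0..1}"
      by (rule has_integral_eq[rotated])
    from has_integral_unique[OF this I] show ?thesis by simp
  qed
  have "G i a = ?F' a i" for i by (simp add: G_def)
  with sm ex show thesis using that by blast
qed

section \<open>Smooth functions on a manifold\<close>

lemma chartE:
  assumes "smooth_manifold A" "(U, c) \<in> A"
  shows "open U" "open (c ` U)" "continuous_on U c" "continuous_on (c ` U) (inv_into U c)"
    "\<And>x. x \<in> U \<Longrightarrow> inv_into U c (c x) = x" "\<And>V. V \<subseteq> U \<Longrightarrow> open V \<Longrightarrow> open (c ` V)"
proof -
  have h: "open U" "open (c ` U)" "homeomorphism U (c ` U) c (inv_into U c)"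
    using assms by (auto simp: smooth_manifold_def is_chart_def)
  then show "open U" "open (c ` U)" "continuous_on U c" "continuous_on (c ` U) (inv_into U c)"
    "\<And>x. x \<in> U \<Longrightarrow> inv_into U c (c x) = x"
    by (auto simp: homeomorphism_def)
  fix V assume V: "V \<subseteq> U" "open V"
  then have "c ` V = c ` U \<inter> inv_into U c -` V"
    using h(3) by (auto simp: homeomorphism_def image_iff)
  then show "open (c ` V)"
    using continuous_open_preimage[OF _ h(2) V(2), of "inv_into U c"] h(3)
    by (simp add: homeomorphism_def)
qed

lemma chart_at:
  assumes "smooth_manifold A"
  obtains U c where "(U, c) \<in> A" "p \<in> U"
proof -
  have "p \<in> (\<Union>(U, c)\<in>A. U)" using assms by (simp add: smooth_manifold_def)
  then show thesis using that by auto
qed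

lemma smooth_functionsD:
  "f \<in> smooth_functions A \<Longrightarrow> (U, c) \<in> A \<Longrightarrow> smooth_on (c ` U) (f \<circ> inv_into U c)"
  by (auto simp: smooth_functions_def)

lemma smooth_functionsI:
  "(\<And>U c. (U, c) \<in> A \<Longrightarrow> smooth_on (c ` U) (f \<circ> inv_into U c)) \<Longrightarrow> f \<in> smooth_functions A"
  by (auto simp: smooth_functions_def)

lemma smooth_functions_const: "(\<lambda>x. k) \<in> smooth_functions A"
  by (rule smooth_functionsI) (simp add: o_def smooth_on_const)

lemma smooth_functions_add:
  assumes M: "smooth_manifold A" and fh: "f \<in> smooth_functions A" "h \<in> smooth_functions A"
  shows "(\<lambda>x. f x + h x) \<in> smooth_functions A"
proof (rule smooth_functionsI)
  fix U c assume *: "(U, c) \<in> A"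
  show "smooth_on (c ` U) ((\<lambda>x. f x + h x) \<circ> inv_into U c)"
    using smooth_on_add[OF chartE(2)[OF M *] fh[THEN smooth_functionsD, OF *]] by (simp add: o_def)
qed

lemma smooth_functions_mult:
  assumes M: "smooth_manifold A" and fh: "f \<in> smooth_functions A" "h \<in> smooth_functions A"
  shows "(\<lambda>x. f x * h x) \<in> smooth_functions A"
proof (rule smooth_functionsI)
  fix U c assume *: "(U, c) \<in> A"
  show "smooth_on (c ` U) ((\<lambda>x. f x * h x) \<circ> inv_into U c)"
    using smooth_on_mult[OF chartE(2)[OF M *] fh[THEN smooth_functionsD, OF *]] by (simp add: o_def)
qed

lemma smooth_functions_diff:
  assumes M: "smooth_manifold A" and fh: "f \<in> smooth_functions A" "h \<in> smooth_functions A"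
  shows "(\<lambda>x. f x - h x) \<in> smooth_functions A"
  using smooth_functions_add[OF M fh(1) smooth_functions_mult[OF M smooth_functions_const[of "-1"] fh(2)]]
  by simp

lemma smooth_functions_sum:
  assumes M: "smooth_manifold A" and "\<And>i. i \<in> I \<Longrightarrow> f i \<in> smooth_functions A"
  shows "(\<lambda>x. \<Sum>i\<in>I. f i x) \<in> smooth_functions A"
  using assms(2)
proof (induction I rule: infinite_finite_induct)
  case (insert i I)
  have "(\<lambda>x. f i x + (\<Sum>i\<in>I. f i x)) \<in> smooth_functions A"
    by (rule smooth_functions_add[OF M]) (use insert in auto)
  then show ?case using insert.hyps by simp
qed (simp_all add: smooth_functions_const)

text \<open>A function given in a chart and cut off with compact support is continued by \<open>0\<close>. The Hausdorff
  property enters here: the preimage of the support is compact, hence closed, so its complement is an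
  open set on which the continued function vanishes.\<close>

lemma smooth_functions_extend:
  fixes A :: "('m::{second_countable_topology, t2_space}, 'e::euclidean_space) atlas"
  assumes M: "smooth_manifold A" and ch: "(U, c) \<in> A"
    and K: "compact K" "K \<subseteq> T" "T \<subseteq> c ` U" "open T"
    and \<beta>: "smooth_on UNIV \<beta>" "\<And>y. y \<notin> K \<Longrightarrow> \<beta> y = 0" and k: "smooth_on T k"
  shows "(\<lambda>x. if x \<in> U then \<beta> (c x) * k (c x) else 0) \<in> smooth_functions A" (is "?f \<in> _")
proof (rule smooth_functionsI)
  fix V d assume ch': "(V, d) \<in> A"
  note C = chartE[OF M ch] and D = chartE[OF M ch']
  define L where "L = inv_into U c ` K"
  have "compact L" unfolding L_def
    by (rule compact_continuous_image[OF continuous_on_subset[OF C(4)] K(1)]) (use K in auto)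
  then have L: "closed L" by (rule compact_imp_closed)
  let ?T = "U \<inter> c -` T"
  have oT: "open ?T" using continuous_open_preimage[OF C(3) C(1) K(4)] .
  show "smooth_on (d ` V) (?f \<circ> inv_into V d)"
  proof (rule smooth_on_local)
    fix y assume "y \<in> d ` V"
    then obtain x where x: "x \<in> V" "y = d x" by auto
    show "\<exists>S. open S \<and> y \<in> S \<and> smooth_on S (?f \<circ> inv_into V d)"
    proof (cases "x \<in> ?T")
      case True
      let ?S = "d ` (V \<inter> ?T)"
      have o: "open ?S" using D(6) oT D(1) by auto
      have "smooth_on (d ` (V \<inter> U)) (c \<circ> inv_into V d)"
        using M ch ch' by (auto simp: smooth_manifold_def)
      then have tr: "smooth_on ?S (\<lambda>y. c (inv_into V d y))"
        using smooth_on_subset[of ?S "d ` (V \<inter> U)"] by (auto simp: o_def)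
      have im: "(\<lambda>y. c (inv_into V d y)) ` ?S \<subseteq> T" using D(5) by auto
      have "smooth_on ?S (\<lambda>y. \<beta> (c (inv_into V d y)) * k (c (inv_into V d y)))"
        by (intro smooth_on_mult[OF o] smooth_on_compose[OF o im k tr]
            smooth_on_compose[OF o subset_UNIV \<beta>(1) tr])
      then have "smooth_on ?S (?f \<circ> inv_into V d)"
        by (rule smooth_on_cong[OF o, rotated]) (use D(5) in auto)
      then show ?thesis using o True x by blast
    next
      case False
      let ?S = "d ` (V - L)"
      have "x \<notin> L"
      proof
        assume "x \<in> L"
        then obtain z where "z \<in> K" "x = inv_into U c z" by (auto simp: L_def)
        moreover have "z \<in> c ` U" using \<open>z \<in> K\<close> K by auto
        ultimately have "x \<in> ?T" using K by (auto simp: inv_into_into f_inv_into_f)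
        then show False using False by simp
      qed
      have o: "open ?S" using D(6) L D(1) by (simp add: open_Diff)
      have "c x \<notin> K" if "x \<in> U" "x \<notin> L" for x
        using C(5)[OF that(1)] that unfolding L_def by (metis imageI)
      then have "smooth_on ?S (?f \<circ> inv_into V d)"
        by (intro smooth_on_cong[OF o _ smooth_on_const[of _ 0]]) (use D(5) \<beta>(2) in auto)
      then show ?thesis using o x \<open>x \<notin> L\<close> by blast
    qed
  qed
qed

lemma cutoff_exists:
  fixes A :: "('m::{second_countable_topology, t2_space}, 'e::euclidean_space) atlas"
  assumes M: "smooth_manifold A" and ch: "(U, c) \<in> A" and p: "p \<in> U" "p \<in> N" "open N"
  obtains \<beta> K W where "smooth_on UNIV \<beta>" "compact K" "K \<subseteq> c ` (U \<inter> N)" "\<And>y. y \<notin> K \<Longrightarrow> \<beta> y = 0"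
    "open W" "p \<in> W" "W \<subseteq> U \<inter> N" "\<And>x. x \<in> W \<Longrightarrow> \<beta> (c x) = (1::real)"
proof -
  note C = chartE[OF M ch]
  have "open (c ` (U \<inter> N))" using C(6) C(1) p(3) by auto
  then obtain r where r: "r > 0" "cball (c p) r \<subseteq> c ` (U \<inter> N)"
    using p open_contains_cball by (metis IntI imageI)
  obtain \<beta> s where \<beta>: "smooth_on UNIV \<beta>" "0 < s" "\<And>x. x \<in> ball (c p) s \<Longrightarrow> \<beta> x = (1::real)"
    "\<And>x. x \<notin> cball (c p) r \<Longrightarrow> \<beta> x = 0"
    by (rule bump_exists[OF r(1), of "c p"], rule that)
  let ?W = "(U \<inter> c -` ball (c p) s) \<inter> N"
  have "open ?W" using continuous_open_preimage[OF C(3) C(1)] p(3) by blast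
  then show thesis
    using that[of \<beta> "cball (c p) r" ?W] \<beta> p r by fastforce
qed

section \<open>Derivations are local\<close>

lemma tangent_spaceD:
  assumes "v \<in> tangent_space A p"
  shows "f \<in> smooth_functions A \<Longrightarrow> h \<in> smooth_functions A \<Longrightarrow> v (\<lambda>x. f x + h x) = v f + v h"
    and "f \<in> smooth_functions A \<Longrightarrow> v (\<lambda>x. k * f x) = k * v f"
    and "f \<in> smooth_functions A \<Longrightarrow> h \<in> smooth_functions A \<Longrightarrow>
      v (\<lambda>x. f x * h x) = f p * v h + h p * v f"
    and "f \<notin> smooth_functions A \<Longrightarrow> v f = 0"
  using assms by (auto simp: tangent_space_def)

lemma tangent_const:
  assumes v: "v \<in> tangent_space A p"
  shows "v (\<lambda>x. k) = 0"
proof -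
  have "v (\<lambda>x. 1 * 1) = 1 * v (\<lambda>x. 1) + 1 * v (\<lambda>x. 1)"
    by (rule tangent_spaceD(3)[OF v]) (auto simp: smooth_functions_const)
  then show ?thesis
    using tangent_spaceD(2)[OF v smooth_functions_const[of 1], of k] by simp
qed

lemma tangent_diff:
  assumes M: "smooth_manifold A" and v: "v \<in> tangent_space A p"
    and "f \<in> smooth_functions A" "h \<in> smooth_functions A"
  shows "v (\<lambda>x. f x - h x) = v f - v h"
  using tangent_spaceD(1)[OF v assms(3) smooth_functions_mult[OF M smooth_functions_const[of "-1"] assms(4)]]
    tangent_spaceD(2)[OF v assms(4), of "-1"] by simp

lemma tangent_sum:
  assumes M: "smooth_manifold A" and v: "v \<in> tangent_space A p"
    and "\<And>i. i \<in> I \<Longrightarrow> f i \<in> smooth_functions A"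
  shows "v (\<lambda>x. \<Sum>i\<in>I. f i x) = (\<Sum>i\<in>I. v (f i))"
  using assms(3)
proof (induction I rule: infinite_finite_induct)
  case (insert i I)
  then have "v (\<lambda>x. f i x + (\<Sum>i\<in>I. f i x)) = v (f i) + v (\<lambda>x. \<Sum>i\<in>I. f i x)"
    by (intro tangent_spaceD(1)[OF v] smooth_functions_sum[OF M]) auto
  then show ?case using insert by simp
qed (simp_all add: tangent_const[OF v])

text \<open>If \<open>b\<close> is a bump function at \<open>p\<close> supported in \<open>N\<close>, then \<open>b (f - h) = 0\<close> and the product rule gives
  \<open>0 = v (b (f - h)) = v (f - h)\<close>.\<close>

lemma tangent_local:
  fixes A :: "('m::{second_countable_topology, t2_space}, 'e::euclidean_space) atlas"
  assumes M: "smooth_manifold A" and v: "v \<in> tangent_space A p"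
    and f: "f \<in> smooth_functions A" and h: "h \<in> smooth_functions A"
    and N: "open N" "p \<in> N" "\<And>x. x \<in> N \<Longrightarrow> f x = h x"
  shows "v f = v h"
proof -
  obtain U c where ch: "(U, c) \<in> A" and p: "p \<in> U" using chart_at[OF M] .
  obtain \<beta> K W where b: "smooth_on UNIV \<beta>" "compact K" "K \<subseteq> c ` (U \<inter> N)"
      "\<And>y. y \<notin> K \<Longrightarrow> \<beta> y = 0" "open W" "p \<in> W" "W \<subseteq> U \<inter> N" "\<And>x. x \<in> W \<Longrightarrow> \<beta> (c x) = (1::real)"
    by (rule cutoff_exists[OF M ch p N(2,1)], rule that)
  define b where "b = (\<lambda>x. if x \<in> U then \<beta> (c x) * 1 else 0)"
  have bs: "b \<in> smooth_functions A" unfolding b_def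
    by (rule smooth_functions_extend[OF M ch b(2), of "c ` U"])
      (use b chartE(2)[OF M ch] smooth_on_const in auto)
  have z: "b x * (f x - h x) = 0" for x
  proof (cases "x \<in> U \<and> c x \<in> K")
    case True
    then obtain x' where "x' \<in> U \<inter> N" "c x = c x'" using b(3) by auto
    then have "x \<in> N" using chartE(5)[OF M ch] True by (metis IntD1 IntD2)
    then show ?thesis using N(3) by simp
  qed (use b(4) b_def in auto)
  have "0 = v (\<lambda>x. b x * (f x - h x))" by (simp add: z tangent_const[OF v])
  also have "\<dots> = b p * v (\<lambda>x. f x - h x) + (f p - h p) * v b"
    by (rule tangent_spaceD(3)[OF v bs smooth_functions_diff[OF M f h]])
  also have "\<dots> = v f - v h" using p b(6,8) N by (simp add: b_def tangent_diff[OF M v f h])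
  finally show ?thesis by simp
qed

section \<open>Local frames\<close>

text \<open>\<open>h i\<close> and \<open>Y i\<close> are the coordinate functions and the coordinate vector fields of a chart around \<open>p\<close>,
  cut off so as to be global; on \<open>W\<close> the cutoff is \<open>1\<close>. Every derivation \<open>w\<close> at a point of \<open>W\<close> is a
  combination of the \<open>Y i\<close>: write \<open>f - f q\<close> near \<open>q\<close> by Hadamard's lemma as the sum of the
  \<open>(h i - h i q) G\<^sub>i\<close> and apply the product rule. Since the \<open>Y i\<close> are partial derivatives, they vanish on
  functions with a local minimum at \<open>p\<close>.\<close>

lemma local_frame:
  fixes A :: "('m::{second_countable_topology, t2_space}, 'e::euclidean_space) atlas"
  assumes M: "smooth_manifold A"
  obtains W and h :: "'e \<Rightarrow> 'm \<Rightarrow> real" and Y :: "'e \<Rightarrow> 'm vfield"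
  where "open W" "p \<in> W" "\<And>i. h i \<in> smooth_functions A" "\<And>i. Y i \<in> vector_fields A"
    "\<And>q w f. q \<in> W \<Longrightarrow> w \<in> tangent_space A q \<Longrightarrow> w f = (\<Sum>i\<in>Basis. w (h i) * Y i q f)"
    "\<And>i q. i \<in> Basis \<Longrightarrow> q \<in> W \<Longrightarrow> Y i q (h i) = 1"
    "\<And>i f N. f \<in> smooth_functions A \<Longrightarrow> open N \<Longrightarrow> p \<in> N \<Longrightarrow> (\<And>q. q \<in> N \<Longrightarrow> f p \<le> f q) \<Longrightarrow> Y i p f = 0"
proof -
  obtain U c where ch: "(U, c) \<in> A" and p: "p \<in> U" using chart_at[OF M] .
  note C = chartE[OF M ch]
  let ?ci = "inv_into U c"
  obtain \<beta> K W where b: "smooth_on UNIV \<beta>" "compact K" "K \<subseteq> c ` (U \<inter> UNIV)"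
      "\<And>y. y \<notin> K \<Longrightarrow> \<beta> y = 0" "open W" "p \<in> W" "W \<subseteq> U \<inter> UNIV" "\<And>x. x \<in> W \<Longrightarrow> \<beta> (c x) = (1::real)"
    by (rule cutoff_exists[OF M ch p UNIV_I open_UNIV], rule that)
  note b = b[unfolded Int_UNIV_right]
  define h where "h = (\<lambda>i x. if x \<in> U then \<beta> (c x) * (c x \<bullet> i) else 0)"
  define Y where "Y = (\<lambda>i q f. if f \<in> smooth_functions A then
      (if q \<in> U then \<beta> (c q) * frechet_derivative (f \<circ> ?ci) (at (c q)) i else 0) else 0)"
  have hs: "h i \<in> smooth_functions A" for i unfolding h_def
    by (rule smooth_functions_extend[OF M ch b(2,3) order_refl C(2) b(1,4)])
      (auto intro: smooth_on_bounded_linear bounded_linear_inner_left)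
  have fd: "((f \<circ> ?ci) has_derivative frechet_derivative (f \<circ> ?ci) (at (c q))) (at (c q))"
    if "f \<in> smooth_functions A" "q \<in> U" for f q
    by (rule smooth_on_imp_has_derivative[OF smooth_functionsD[OF that(1) ch]]) (use that in auto)
  have Yt: "Y i q \<in> tangent_space A q" for i q
  proof -
    let ?D = "\<lambda>f. frechet_derivative (f \<circ> ?ci) (at (c q)) i"
    have "?D (\<lambda>x. f x + k x) = ?D f + ?D k \<and> ?D (\<lambda>x. a * f x) = a * ?D f \<and>
        ?D (\<lambda>x. f x * k x) = f q * ?D k + k q * ?D f"
      if "f \<in> smooth_functions A" "k \<in> smooth_functions A" "q \<in> U" for f k a
    proof -
      note f = fd[OF that(1,3)] and k = fd[OF that(2,3)]
      show ?thesis
        using fun_cong[OF frechet_derivative_at[OF has_derivative_add[OF f k]], of i]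
          fun_cong[OF frechet_derivative_at[OF has_derivative_mult_right[OF f, of a]], of i]
          fun_cong[OF frechet_derivative_at[OF has_derivative_mult[OF f k]], of i]
        by (simp add: o_def C(5)[OF that(3)] mult.commute)
    qed
    then show ?thesis
      by (auto simp: tangent_space_def Y_def smooth_functions_add[OF M] smooth_functions_mult[OF M]
          smooth_functions_const algebra_simps)
  qed
  have "(\<lambda>q. Y i q f) \<in> smooth_functions A" if f: "f \<in> smooth_functions A" for i f
  proof -
    have "(\<lambda>q. Y i q f) = (\<lambda>q. if q \<in> U then \<beta> (c q) * frechet_derivative (f \<circ> ?ci) (at (c q)) i else 0)"
      using f by (auto simp: Y_def)
    also have "\<dots> \<in> smooth_functions A"
      by (rule smooth_functions_extend[OF M ch b(2,3) order_refl C(2) b(1,4)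
            smooth_on_frechet_derivative[OF smooth_functionsD[OF f ch]]])
    finally show ?thesis .
  qed
  then have Yv: "Y i \<in> vector_fields A" for i using Yt by (simp add: vector_fields_def)
  have rep: "w f = (\<Sum>i\<in>Basis. w (h i) * Y i q f)"
    if q: "q \<in> W" and w: "w \<in> tangent_space A q" for q w f
  proof (cases "f \<in> smooth_functions A")
    case False
    then show ?thesis using tangent_spaceD(4)[OF w] by (simp add: Y_def)
  next
    case f: True
    let ?a = "c q"
    have qU: "q \<in> U" using q b(7) by auto
    then obtain R where R: "R > 0" "ball ?a R \<subseteq> c ` U"
      using openE[OF C(2)] by blast
    obtain G where G: "\<And>i. smooth_on (ball ?a R) (G i)"
      "\<And>x. x \<in> ball ?a R \<Longrightarrow> (f \<circ> ?ci) x = (f \<circ> ?ci) ?a + (\<Sum>i\<in>Basis. ((x - ?a) \<bullet> i) * G i x)"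
      "\<And>i. i \<in> Basis \<Longrightarrow> G i ?a = frechet_derivative (f \<circ> ?ci) (at ?a) i"
      by (rule Hadamard[OF smooth_on_subset[OF R(2) smooth_functionsD[OF f ch]] R(1)], rule that)
    define N where "N = W \<inter> (U \<inter> c -` ball ?a R)"
    have N: "open N" "q \<in> N"
      unfolding N_def using continuous_open_preimage[OF C(3) C(1) open_ball] b(5) q qU R by auto
    obtain \<gamma> L W' where g: "smooth_on UNIV \<gamma>" "compact L" "L \<subseteq> c ` (U \<inter> N)"
      "\<And>y. y \<notin> L \<Longrightarrow> \<gamma> y = 0" "open W'" "q \<in> W'" "W' \<subseteq> U \<inter> N" "\<And>x. x \<in> W' \<Longrightarrow> \<gamma> (c x) = (1::real)"
      by (rule cutoff_exists[OF M ch qU N(2,1)], rule that)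
    \<comment> \<open>The functions \<open>G i\<close> live on a ball only, so they need a second cutoff \<open>\<gamma>\<close> inside that ball.\<close>
    define k where "k = (\<lambda>i x. if x \<in> U then \<gamma> (c x) * G i (c x) else 0)"
    have "L \<subseteq> ball ?a R" using g(3) by (auto simp: N_def)
    then have ks: "k i \<in> smooth_functions A" for i unfolding k_def
      by (rule smooth_functions_extend[OF M ch g(2) _ R(2) open_ball g(1,4) G(1)])
    define l where "l = (\<lambda>i x. h i x - ?a \<bullet> i)"
    have ls: "l i \<in> smooth_functions A" for i unfolding l_def
      by (rule smooth_functions_diff[OF M hs smooth_functions_const])
    have lw: "w (l i) = w (h i)" for i
      unfolding l_def using tangent_diff[OF M w hs smooth_functions_const] tangent_const[OF w] by simp
    have lq: "l i q = 0" for i using qU b(8)[OF q] by (simp add: l_def h_def)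
    have kq: "k i q = Y i q f" if "i \<in> Basis" for i
      using qU b(8)[OF q] g(8)[OF g(6)] G(3)[OF that] f by (simp add: k_def Y_def)
    have ss: "(\<lambda>x. \<Sum>i\<in>Basis. l i x * k i x) \<in> smooth_functions A"
      by (intro smooth_functions_sum smooth_functions_mult ks ls M)
    have "w f = w (\<lambda>x. f q + (\<Sum>i\<in>Basis. l i x * k i x))"
    proof (rule tangent_local[OF M w f _ g(5,6)])
      show "(\<lambda>x. f q + (\<Sum>i\<in>Basis. l i x * k i x)) \<in> smooth_functions A"
        by (rule smooth_functions_add[OF M smooth_functions_const ss])
      fix x assume x: "x \<in> W'"
      then have "x \<in> N" "x \<in> U" "x \<in> W" using g(7) by (auto simp: N_def)
      then have "f x = f q + (\<Sum>i\<in>Basis. ((c x - ?a) \<bullet> i) * G i (c x))"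
        using G(2)[of "c x"] C(5) qU by (simp add: N_def)
      then show "f x = f q + (\<Sum>i\<in>Basis. l i x * k i x)"
        using \<open>x \<in> U\<close> b(8)[OF \<open>x \<in> W\<close>] g(8)[OF x] by (simp add: l_def k_def h_def inner_diff_left)
    qed
    also have "\<dots> = w (\<lambda>x. \<Sum>i\<in>Basis. l i x * k i x)"
      using tangent_spaceD(1)[OF w smooth_functions_const ss] tangent_const[OF w] by simp
    also have "\<dots> = (\<Sum>i\<in>Basis. w (\<lambda>x. l i x * k i x))"
      by (rule tangent_sum[OF M w smooth_functions_mult[OF M ls ks]])
    also have "\<dots> = (\<Sum>i\<in>Basis. w (h i) * Y i q f)"
      by (rule sum.cong) (simp_all add: tangent_spaceD(3)[OF w ls ks] lq lw kq)
    finally show ?thesis .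
  qed
  have dual: "Y i q (h i) = 1" if "i \<in> Basis" "q \<in> W" for i q
  proof -
    have "((\<lambda>y. y \<bullet> i) has_derivative (\<lambda>v. v \<bullet> i)) (at (c q))"
      by (rule bounded_linear_imp_has_derivative[OF bounded_linear_inner_left])
    then have "((h i \<circ> ?ci) has_derivative (\<lambda>v. v \<bullet> i)) (at (c q))"
      by (rule has_derivative_transform_within_open[where s="c ` W"])
        (use C(5,6) b that in \<open>auto simp: h_def subset_iff\<close>)
    then have "frechet_derivative (h i \<circ> ?ci) (at (c q)) = (\<lambda>v. v \<bullet> i)"
      using frechet_derivative_at by metis
    then show ?thesis using that b hs by (auto simp: Y_def)
  qed
  have min: "Y i p f = 0"
    if "f \<in> smooth_functions A" "open N" "p \<in> N" "\<And>q. q \<in> N \<Longrightarrow> f p \<le> f q" for i f N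
  proof -
    have "frechet_derivative (f \<circ> ?ci) (at (c p)) = (\<lambda>v. 0)"
      by (rule differential_zero_maxmin[OF _ _ fd[OF that(1) p], of "c ` (U \<inter> N)"])
        (use that p C(5) C(6)[of "U \<inter> N"] C(1) in auto)
    then show ?thesis by (simp add: Y_def)
  qed
  show thesis by (rule that[OF b(5,6) hs Yv rep dual min])
qed

text \<open>Take the combination of the \<open>Y i\<close> of a local frame with the constant coefficients of \<open>u\<close>.\<close>

lemma tangent_extend:
  fixes A :: "('m::{second_countable_topology, t2_space}, 'e::euclidean_space) atlas"
  assumes M: "smooth_manifold A" and u: "u \<in> tangent_space A p"
  obtains X where "X \<in> vector_fields A" "X p = u"
proof -
  obtain W and h :: "'e \<Rightarrow> 'm \<Rightarrow> real" and Y where F: "p \<in> W" "\<And>i. Y i \<in> vector_fields A"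
    "\<And>q w f. q \<in> W \<Longrightarrow> w \<in> tangent_space A q \<Longrightarrow> w f = (\<Sum>i\<in>Basis. w (h i) * Y i q f)"
    by (rule local_frame[OF M, of p]) blast
  define X where "X = (\<lambda>q f. \<Sum>i\<in>Basis. u (h i) * Y i q f)"
  have Yt: "Y i q \<in> tangent_space A q" for i q using F(2)[of i] by (simp add: vector_fields_def)
  have Xt: "X q \<in> tangent_space A q" for q
    unfolding tangent_space_def mem_Collect_eq X_def
    by (simp add: tangent_spaceD[OF Yt] sum.distrib sum_distrib_left algebra_simps)
  have "(\<lambda>q. X q f) \<in> smooth_functions A" if "f \<in> smooth_functions A" for f
    unfolding X_def using F(2) that
    by (intro smooth_functions_sum smooth_functions_mult smooth_functions_const M)
      (auto simp: vector_fields_def)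
  then have "X \<in> vector_fields A" using Xt by (simp add: vector_fields_def)
  moreover have "X p = u" unfolding X_def by (rule ext) (rule F(3)[OF F(1) u, symmetric])
  ultimately show thesis by (rule that)
qed

section \<open>Linear algebra of tangent spaces\<close>

lemma vector_space_scaleT: "vector_space (scaleT :: real \<Rightarrow> 'm tvec \<Rightarrow> 'm tvec)"
  by unfold_locales (auto simp: scaleT_def plus_fun_def algebra_simps)

lemma subspace_tangent_space: "module.subspace scaleT (tangent_space A p)"
proof -
  interpret vector_space scaleT by (rule vector_space_scaleT)
  show ?thesis
    unfolding subspace_def by (auto simp: tangent_space_def scaleT_def plus_fun_def zero_fun_def algebra_simps)
qed

lemma tangent_space_finite_dim:
  fixes A :: "('m::{second_countable_topology, t2_space}, 'e::euclidean_space) atlas"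
  assumes M: "smooth_manifold A"
  obtains S where "finite S" "tangent_space A p \<subseteq> module.span scaleT S"
proof -
  interpret vector_space scaleT by (rule vector_space_scaleT)
  obtain W and h :: "'e \<Rightarrow> 'm \<Rightarrow> real" and Y where F: "p \<in> W"
    "\<And>q w f. q \<in> W \<Longrightarrow> w \<in> tangent_space A q \<Longrightarrow> w f = (\<Sum>i\<in>Basis. w (h i) * Y i q f)"
    by (rule local_frame[OF M, of p]) blast
  have ap: "(\<Sum>i\<in>I. f i) x = (\<Sum>i\<in>I. f i x)" for I :: "'e set" and f :: "'e \<Rightarrow> 'm tvec" and x
    by (induction I rule: infinite_finite_induct) auto
  have "w \<in> span ((\<lambda>i. Y i p) ` Basis)" if "w \<in> tangent_space A p" for w
  proof -
    have "w = (\<Sum>i\<in>Basis. w (h i) \<odot> Y i p)"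
      by (rule ext, subst F(2)[OF F(1) that]) (simp add: ap scaleT_def)
    also have "\<dots> \<in> span ((\<lambda>i. Y i p) ` Basis)"
      by (intro span_sum span_scale span_base) auto
    finally show ?thesis .
  qed
  then show thesis using that[of "(\<lambda>i. Y i p) ` Basis"] by auto
qed

locale tangent_metric =
  fixes A :: "('m::{second_countable_topology, t2_space}, 'e::euclidean_space) atlas"
    and g :: "'m \<Rightarrow> 'm tvec \<Rightarrow> 'm tvec \<Rightarrow> real"
  assumes M: "smooth_manifold A" and R: "riemannian_metric A g"
begin

sublocale tv: vector_space "scaleT :: real \<Rightarrow> 'm tvec \<Rightarrow> 'm tvec"
  by (rule vector_space_scaleT)

lemmas tangent_closed =
  tv.subspace_0[OF subspace_tangent_space[of A]] tv.subspace_add[OF subspace_tangent_space[of A]]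
  tv.subspace_diff[OF subspace_tangent_space[of A]] tv.subspace_scale[OF subspace_tangent_space[of A]]

lemma g_sym: "u \<in> tangent_space A p \<Longrightarrow> v \<in> tangent_space A p \<Longrightarrow> g p u v = g p v u"
  using R by (auto simp: riemannian_metric_def)

lemma g_pos: "u \<in> tangent_space A p \<Longrightarrow> u \<noteq> 0 \<Longrightarrow> g p u u > 0"
  using R by (auto simp: riemannian_metric_def)

lemma g_lin:
  "u \<in> tangent_space A p \<Longrightarrow> v \<in> tangent_space A p \<Longrightarrow> w \<in> tangent_space A p \<Longrightarrow>
    g p (a \<odot> u + b \<odot> v) w = a * g p u w + b * g p v w"
  using R by (auto simp: riemannian_metric_def)

lemma g_add:
  "u \<in> tangent_space A p \<Longrightarrow> v \<in> tangent_space A p \<Longrightarrow> w \<in> tangent_space A p \<Longrightarrow>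
    g p (u + v) w = g p u w + g p v w"
  using g_lin[of u p v w 1 1] by simp

lemma g_diff:
  "u \<in> tangent_space A p \<Longrightarrow> v \<in> tangent_space A p \<Longrightarrow> w \<in> tangent_space A p \<Longrightarrow>
    g p (u - v) w = g p u w - g p v w"
  using g_lin[of u p v w 1 "-1"] by simp

lemma g_scale:
  "u \<in> tangent_space A p \<Longrightarrow> w \<in> tangent_space A p \<Longrightarrow> g p (a \<odot> u) w = a * g p u w"
  using g_lin[of u p u w a 0] by simp

lemma g_zero: "w \<in> tangent_space A p \<Longrightarrow> g p 0 w = 0"
  using g_scale[of w p w 0] by simp

lemma g_add_right:
  "u \<in> tangent_space A p \<Longrightarrow> v \<in> tangent_space A p \<Longrightarrow> w \<in> tangent_space A p \<Longrightarrow>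
    g p w (u + v) = g p w u + g p w v"
  using g_add g_sym tangent_closed by metis

lemma g_scale_right:
  "u \<in> tangent_space A p \<Longrightarrow> w \<in> tangent_space A p \<Longrightarrow> g p w (a \<odot> u) = a * g p w u"
  using g_scale g_sym tangent_closed by metis

lemma g_sum:
  assumes "\<And>i. i \<in> I \<Longrightarrow> Y i \<in> tangent_space A p" "w \<in> tangent_space A p"
  shows "g p (\<lambda>f. \<Sum>i\<in>I. a i * Y i f) w = (\<Sum>i\<in>I. a i * g p (Y i) w)"
proof -
  have "g p (\<lambda>f. \<Sum>i\<in>I. a i * Y i f) w = (\<Sum>i\<in>I. a i * g p (Y i) w) \<and>
      (\<lambda>f. \<Sum>i\<in>I. a i * Y i f) \<in> tangent_space A p"
    using assms(1)
  proof (induction I rule: infinite_finite_induct)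
    case (insert i I)
    have "(\<lambda>f. \<Sum>i\<in>insert i I. a i * Y i f) = a i \<odot> Y i + (\<lambda>f. \<Sum>i\<in>I. a i * Y i f)"
      using insert.hyps by (simp add: scaleT_def fun_eq_iff)
    then show ?case
      using insert assms(2) by (simp add: g_add g_scale tangent_closed)
  qed (use g_zero[OF assms(2)] tangent_closed(1) in \<open>auto simp: zero_fun_def\<close>)
  then show ?thesis ..
qed

text \<open>With a frame of vector fields the entries \<open>g p (Y i) (Y j)\<close> depend smoothly on \<open>p\<close>. This gives access to
  the smoothness of \<open>g\<close> for families of tangent vectors that are not vector fields, such as \<open>d\<pi> X\<close>.\<close>

lemma g_frame:
  assumes Y: "\<And>i. Y i \<in> tangent_space A p"
    and u: "u \<in> tangent_space A p" "\<And>f. u f = (\<Sum>i\<in>I. a i * Y i f)"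
    and v: "v \<in> tangent_space A p" "\<And>f. v f = (\<Sum>j\<in>I. b j * Y j f)"
  shows "g p u v = (\<Sum>i\<in>I. \<Sum>j\<in>I. a i * b j * g p (Y i) (Y j))"
proof -
  have uv: "u = (\<lambda>f. \<Sum>i\<in>I. a i * Y i f)" "v = (\<lambda>f. \<Sum>j\<in>I. b j * Y j f)"
    using u(2) v(2) by (auto intro: ext)
  have "g p u v = (\<Sum>i\<in>I. a i * g p (Y i) v)"
    unfolding uv(1) by (rule g_sum[OF Y v(1)])
  also have "\<dots> = (\<Sum>i\<in>I. a i * g p v (Y i))" using g_sym[OF Y v(1)] by simp
  also have "\<dots> = (\<Sum>i\<in>I. a i * (\<Sum>j\<in>I. b j * g p (Y j) (Y i)))"
    unfolding uv(2) using g_sum[of I Y p _ b, OF Y Y] by simp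
  also have "\<dots> = (\<Sum>i\<in>I. \<Sum>j\<in>I. a i * b j * g p (Y i) (Y j))"
    using g_sym[OF Y Y] by (simp add: sum_distrib_left mult.assoc)
  finally show ?thesis .
qed

text \<open>Gram-Schmidt: the vector \<open>c\<close> is the component of the new generator \<open>a\<close> orthogonal to the old span.
  If it vanishes then so does \<open>t\<close>, because \<open>0 / 0 = 0\<close>.\<close>

lemma orthogonal_projection_span:
  assumes "finite S" "S \<subseteq> tangent_space A p" "u \<in> tangent_space A p"
  shows "\<exists>v\<in>tv.span S. \<forall>w\<in>tv.span S. g p (u - v) w = 0"
  using assms
proof (induction S arbitrary: u rule: finite_induct)
  case empty
  then have "g p u 0 = 0" using g_sym[OF _ tangent_closed(1)] g_zero by simp
  then show ?case by (simp add: zero_fun_def)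
next
  case (insert a S)
  have sub: "tv.span S \<subseteq> tangent_space A p"
    using tv.span_minimal[OF _ subspace_tangent_space] insert.prems by auto
  obtain v where v: "v \<in> tv.span S" "\<And>w. w \<in> tv.span S \<Longrightarrow> g p (u - v) w = 0"
    using insert.IH insert.prems by blast
  obtain b where b: "b \<in> tv.span S" "\<And>w. w \<in> tv.span S \<Longrightarrow> g p (a - b) w = 0"
    using insert.IH[of a] insert.prems by blast
  define c where "c = a - b"
  define t where "t = g p (u - v) c / g p c c"
  have T: "a \<in> tangent_space A p" "b \<in> tangent_space A p" "v \<in> tangent_space A p"
    "u \<in> tangent_space A p" "c \<in> tangent_space A p"
    using insert.prems b(1) v(1) sub tangent_closed by (auto simp: c_def)
  have tc: "g p (u - v) c = t * g p c c"
  proof (cases "c = 0")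
    case True
    then show ?thesis using T g_sym[OF _ tangent_closed(1)] g_zero tangent_closed by auto
  next
    case False
    then show ?thesis using g_pos[OF T(5)] by (simp add: t_def)
  qed
  have "g p (u - (v + t \<odot> c)) w = 0" if w_in: "w \<in> tv.span (insert a S)" for w
  proof -
    obtain k where k: "w - k \<odot> a \<in> tv.span S"
      using w_in tv.span_breakdown_eq by blast
    define s where "s = (w - k \<odot> a) + k \<odot> b"
    have s: "s \<in> tv.span S" unfolding s_def using k b by (intro tv.span_add tv.span_scale)
    have w: "w = k \<odot> c + s" by (simp add: s_def c_def tv.scale_right_diff_distrib)
    have sT: "s \<in> tangent_space A p" using s sub by auto
    have "g p (u - (v + t \<odot> c)) w = g p ((u - v) - t \<odot> c) w" by (simp add: algebra_simps)
    also have "\<dots> = k * (g p (u - v) c - t * g p c c) + (g p (u - v) s - t * g p c s)"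
      unfolding w using T sT
      by (simp add: g_diff[of "u - v" p "t \<odot> c"] g_scale g_add_right g_scale_right tangent_closed
          right_diff_distrib)
    also have "\<dots> = 0" using tc v(2)[OF s] b(2)[OF s] by (simp add: c_def)
    finally show ?thesis .
  qed
  moreover have "v + t \<odot> c \<in> tv.span (insert a S)"
    unfolding c_def using v(1) b(1) tv.span_mono[of S "insert a S"]
    by (intro tv.span_add tv.span_scale tv.span_diff) (auto intro: tv.span_base)
  ultimately show ?case by blast
qed

lemma orthogonal_projection:
  assumes V: "tv.subspace V" "V \<subseteq> tangent_space A p" and u: "u \<in> tangent_space A p"
  obtains v where "v \<in> V" "\<And>w. w \<in> V \<Longrightarrow> g p (u - v) w = 0"
proof -
  obtain S where S: "finite S" "tangent_space A p \<subseteq> tv.span S" by (rule tangent_space_finite_dim[OF M])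
  obtain C where C: "C \<subseteq> V" "tv.independent C" "V \<subseteq> tv.span C" by (rule tv.basis_exists[of V], rule that)
  have "finite C" using tv.independent_span_bound[OF S(1) C(2)] C(1) V(2) S(2) by blast
  then obtain v where "v \<in> tv.span C" "\<forall>w\<in>tv.span C. g p (u - v) w = 0"
    using orthogonal_projection_span[of C p u] C(1) V(2) u by blast
  then show thesis using that[of v] C tv.span_minimal[OF C(1) V(1)] by blast
qed

end

section \<open>Riemannian submersions\<close>

text \<open>Over a chart \<open>d\<close> around \<open>\<pi> x\<close> this is the composition of \<open>h \<circ> inv d\<close> with \<open>d \<circ> \<pi> \<circ> inv c\<close>.\<close>

lemma smooth_functions_pullback:
  assumes MA: "smooth_manifold A" and MB: "smooth_manifold B"
    and \<pi>: "smooth_map A B \<pi>" and h: "h \<in> smooth_functions B"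
  shows "h \<circ> \<pi> \<in> smooth_functions A"
proof (rule smooth_functionsI)
  fix U c assume ch: "(U, c) \<in> A"
  note C = chartE[OF MA ch]
  show "smooth_on (c ` U) (h \<circ> \<pi> \<circ> inv_into U c)"
  proof (rule smooth_on_local)
    fix y assume "y \<in> c ` U"
    then obtain x where x: "x \<in> U" "y = c x" by auto
    obtain V d where dh: "(V, d) \<in> B" "\<pi> x \<in> V" using chart_at[OF MB] .
    note D = chartE[OF MB dh(1)]
    let ?S = "c ` (U \<inter> \<pi> -` V)"
    have "open (\<pi> -` V)" using \<pi> D(1) open_vimage by (auto simp: smooth_map_def)
    then have o: "open ?S" using C(6)[of "U \<inter> \<pi> -` V"] C(1) by auto
    have sm: "smooth_on ?S (\<lambda>y. d (\<pi> (inv_into U c y)))"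
      using \<pi> ch dh by (fastforce simp: smooth_map_def o_def)
    have "smooth_on ?S (\<lambda>y. (h \<circ> inv_into V d) (d (\<pi> (inv_into U c y))))"
      by (rule smooth_on_compose[OF o _ smooth_functionsD[OF h dh(1)] sm]) (use C(5) in auto)
    then have "smooth_on ?S (h \<circ> \<pi> \<circ> inv_into U c)"
      by (rule smooth_on_cong[OF o, rotated]) (use C(5) D(5) in auto)
    then show "\<exists>T. open T \<and> y \<in> T \<and> smooth_on T (h \<circ> \<pi> \<circ> inv_into U c)"
      using o x dh by blast
  qed
qed

lemma differential_simps:
  "differential A B \<pi> (u + v) = differential A B \<pi> u + differential A B \<pi> v"
  "differential A B \<pi> (u - v) = differential A B \<pi> u - differential A B \<pi> v"
  "differential A B \<pi> (a \<odot> u) = a \<odot> differential A B \<pi> u"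
  "differential A B \<pi> 0 = 0"
  by (auto simp: differential_def scaleT_def fun_eq_iff)

locale submersion = A: tangent_metric A g + B: tangent_metric B g'
  for A :: "('m::{second_countable_topology, t2_space}, 'e::euclidean_space) atlas" and g
    and B :: "('n::{second_countable_topology, t2_space}, 'd::euclidean_space) atlas" and g' +
  fixes \<pi> :: "'m \<Rightarrow> 'n"
  assumes S: "riemannian_submersion A g B g' \<pi>"
begin

abbreviation "D \<equiv> differential A B \<pi>"

lemma D_tangent: "u \<in> tangent_space A p \<Longrightarrow> D u \<in> tangent_space B (\<pi> p)"
  using S by (auto simp: riemannian_submersion_def)

lemma horizontal_part:
  assumes u: "u \<in> tangent_space A p"
  obtains v where "v \<in> horizontal_space A g B \<pi> p" "u - v \<in> vertical_space A B \<pi> p" "D v = D u"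
proof -
  have V: "A.tv.subspace (vertical_space A B \<pi> p)"
    unfolding A.tv.subspace_def vertical_space_def
    by (auto simp: A.tangent_closed differential_simps)
  have sub: "vertical_space A B \<pi> p \<subseteq> tangent_space A p" by (auto simp: vertical_space_def)
  obtain w where w: "w \<in> vertical_space A B \<pi> p"
    "\<And>z. z \<in> vertical_space A B \<pi> p \<Longrightarrow> g p (u - w) z = 0"
    by (rule A.orthogonal_projection[OF V sub u], rule that)
  have "u - w \<in> tangent_space A p" using A.tangent_closed(3)[OF u] w(1) sub by auto
  then have "u - w \<in> horizontal_space A g B \<pi> p" using w by (simp add: horizontal_space_def)
  then show thesis using that[of "u - w"] w(1) by (simp add: vertical_space_def differential_simps)
qed

text \<open>The isometry of \<open>d\<pi>\<close> on horizontal vectors extends to the case where only one of the two vectors is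
  horizontal, as the vertical part of the other is invisible on both sides.\<close>

lemma g_horizontal:
  assumes u: "u \<in> tangent_space A p" and x: "x \<in> horizontal_space A g B \<pi> p"
  shows "g' (\<pi> p) (D u) (D x) = g p u x"
proof -
  obtain v where v: "v \<in> horizontal_space A g B \<pi> p" "u - v \<in> vertical_space A B \<pi> p" "D v = D u"
    using horizontal_part[OF u] .
  have T: "v \<in> tangent_space A p" "x \<in> tangent_space A p" "u - v \<in> tangent_space A p"
    using v x by (auto simp: horizontal_space_def vertical_space_def)
  have "g' (\<pi> p) (D u) (D x) = g p v x"
    unfolding v(3)[symmetric] using S v(1) x unfolding riemannian_submersion_def by blast
  moreover have "g p x (u - v) = 0" using x v(2) by (simp add: horizontal_space_def)
  then have "g p u x - g p v x = 0"
    using A.g_sym[OF T(2,3)] A.g_diff[OF u T(1,2)] by simp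
  ultimately show ?thesis by simp
qed

text \<open>\<open>d\<pi>\<close> discards the vertical part of \<open>u\<close> and keeps the length of the horizontal part.\<close>

lemma g_contracts:
  assumes u: "u \<in> tangent_space A p"
  shows "g' (\<pi> p) (D u) (D u) \<le> g p u u"
proof -
  obtain v where v: "v \<in> horizontal_space A g B \<pi> p" "u - v \<in> vertical_space A B \<pi> p" "D v = D u"
    using horizontal_part[OF u] .
  have T: "v \<in> tangent_space A p" "u - v \<in> tangent_space A p"
    using v by (auto simp: horizontal_space_def vertical_space_def)
  have 1: "g' (\<pi> p) (D u) (D u) = g p u v" using g_horizontal[OF u v(1)] v(3) by simp
  have 2: "g p v (u - v) = 0" using v by (simp add: horizontal_space_def)
  have "0 \<le> g p (u - v) (u - v)" using A.g_pos[OF T(2)] A.g_zero[OF A.tangent_closed(1)]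
    by (cases "u - v = 0") (auto simp: less_imp_le)
  also have "\<dots> = g p u (u - v)" using A.g_diff[OF u T] 2 by simp
  also have "\<dots> = g p u u - g p u v"
    using A.g_diff[OF u T(1) u] A.g_sym[OF u T(2)] A.g_sym[OF u T(1)] by simp
  finally show ?thesis using 1 by simp
qed

end

section \<open>Almost contact metric and Kenmotsu structures\<close>

text \<open>Evaluate \<open>\<phi> (\<phi> (\<phi> u))\<close> in two ways, as \<open>- \<phi> u + \<eta> (\<phi> u) \<xi>\<close> and as \<open>\<phi> (- u + \<eta> u \<xi>)\<close>. For \<open>u = \<xi>\<close> this
  shows that \<open>\<phi> \<xi>\<close> is a multiple of \<open>\<xi>\<close>, and as \<open>\<phi> (\<phi> \<xi>) = 0\<close> \<open>\<phi> \<xi> = 0\<close>; in general it then gives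
  \<open>\<eta> (\<phi> u) \<xi> = 0\<close>. Compatibility of \<open>g\<close> with \<open>\<phi>\<close> at \<open>(u, \<xi>)\<close> turns into \<open>\<eta> u = g(u, \<xi>)\<close>.\<close>

lemma acm_algebra:
  assumes acm: "almost_contact_metric_manifold A \<phi> \<xi> \<eta> g"
  shows "\<xi> p \<in> tangent_space A p" "\<phi> p (\<xi> p) = 0"
    "\<And>u. u \<in> tangent_space A p \<Longrightarrow> \<eta> p u = g p u (\<xi> p)"
    "\<And>u. u \<in> tangent_space A p \<Longrightarrow> \<eta> p (\<phi> p u) = 0"
    "\<And>u. u \<in> tangent_space A p \<Longrightarrow> \<phi> p u \<in> tangent_space A p"
    "tangent_metric A g"
proof -
  show TM: "tangent_metric A g"
    using acm by (auto simp: almost_contact_metric_manifold_def tangent_metric_def)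
  interpret tangent_metric A g by (rule TM)
  show xi: "\<xi> p \<in> tangent_space A p" for p
    using acm by (auto simp: almost_contact_metric_manifold_def vector_fields_def)
  show \<phi>T: "\<phi> p u \<in> tangent_space A p" if "u \<in> tangent_space A p" for u
    using acm that by (auto simp: almost_contact_metric_manifold_def tensor_11_def)
  have lin: "\<phi> p (a \<odot> u + b \<odot> v) = a \<odot> \<phi> p u + b \<odot> \<phi> p v"
    if "u \<in> tangent_space A p" "v \<in> tangent_space A p" for u v a b
    using acm that by (auto simp: almost_contact_metric_manifold_def tensor_11_def)
  have sq: "\<phi> p (\<phi> p u) = - u + \<eta> p u \<odot> \<xi> p" if "u \<in> tangent_space A p" for u
    using acm that by (auto simp: almost_contact_metric_manifold_def)
  have \<eta>\<xi>: "\<eta> p (\<xi> p) = 1" using acm by (auto simp: almost_contact_metric_manifold_def)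
  have comp: "g p (\<phi> p u) (\<phi> p v) = g p u v - \<eta> p u * \<eta> p v"
    if "u \<in> tangent_space A p" "v \<in> tangent_space A p" for u v
    using acm that by (auto simp: almost_contact_metric_manifold_def)
  have \<phi>0: "\<phi> p 0 = 0" using lin[OF tangent_closed(1) tangent_closed(1), of 0 0] by simp
  have \<phi>\<phi>\<xi>: "\<phi> p (\<phi> p (\<xi> p)) = 0" using sq[OF xi] \<eta>\<xi> by simp
  show \<phi>\<xi>: "\<phi> p (\<xi> p) = 0"
  proof (rule ccontr)
    assume nz: "\<phi> p (\<xi> p) \<noteq> 0"
    let ?k = "\<eta> p (\<phi> p (\<xi> p))"
    have e: "\<phi> p (\<xi> p) = ?k \<odot> \<xi> p"
      using sq[OF \<phi>T[OF xi]] \<phi>\<phi>\<xi> \<phi>0 by (metis add_eq_0_iff minus_minus)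
    have "\<phi> p (?k \<odot> \<xi> p) = ?k \<odot> \<phi> p (\<xi> p)" using lin[OF xi xi, of ?k 0] by simp
    then have "?k \<odot> \<phi> p (\<xi> p) = 0" using e \<phi>\<phi>\<xi> by simp
    then have "?k = 0" using nz tv.scale_eq_0_iff by blast
    then show False using e nz by simp
  qed
  show "\<eta> p u = g p u (\<xi> p)" if "u \<in> tangent_space A p" for u
    using comp[OF that xi] \<phi>\<xi> \<eta>\<xi> g_sym[OF \<phi>T[OF that] tangent_closed(1)] g_zero[OF \<phi>T[OF that]] by simp
  show "\<eta> p (\<phi> p u) = 0" if "u \<in> tangent_space A p" for u
  proof -
    have "\<phi> p ((- 1) \<odot> u + \<eta> p u \<odot> \<xi> p) = - \<phi> p u"
      using lin[OF that xi, of "- 1" "\<eta> p u"] \<phi>\<xi> by simp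
    then have "\<phi> p (\<phi> p (\<phi> p u)) = - \<phi> p u" using sq[OF that] by simp
    then have "\<eta> p (\<phi> p u) \<odot> \<xi> p = 0" using sq[OF \<phi>T[OF that]] by simp
    moreover have "\<xi> p \<noteq> 0"
    proof
      assume "\<xi> p = 0"
      then show False
        using comp[OF xi xi] \<phi>\<xi> \<eta>\<xi> g_zero[OF tangent_closed(1)] by simp
    qed
    ultimately show ?thesis using tv.scale_eq_0_iff by blast
  qed
qed

text \<open>The Kenmotsu equation for \<open>Y = \<xi>\<close> reads \<open>\<phi> (\<nabla>\<^sub>X \<xi>) = \<alpha> \<phi> X\<close>, because \<open>\<phi> \<xi> = 0\<close>. Pairing with \<open>\<phi> X\<close> removes
  \<open>\<phi>\<close> from both sides, as \<open>X\<close> is orthogonal to \<open>\<xi>\<close>. This is the infinitesimal form of the statement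
  that the flow of \<open>\<xi>\<close> rescales the metric on the contact distribution.\<close>

lemma kenmotsu_nabla_xi:
  assumes acm: "almost_contact_metric_manifold A \<phi> \<xi> \<eta> g"
    and aff: "affine_connection A nabla"
    and ken: "\<forall>X\<in>vector_fields A. \<forall>Y\<in>vector_fields A. \<forall>p.
          nabla X (\<lambda>q. \<phi> q (Y q)) p - \<phi> p (nabla X Y p) =
          \<alpha> \<odot> (g p (\<phi> p (X p)) (Y p) \<odot> \<xi> p - \<eta> p (Y p) \<odot> \<phi> p (X p))"
    and X: "X \<in> vector_fields A" and h: "\<eta> p (X p) = 0"
  shows "g p (nabla X \<xi> p) (X p) = \<alpha> * g p (X p) (X p)"
proof -
  interpret tangent_metric A g by (rule acm_algebra(6)[OF acm])
  note al = acm_algebra(1-5)[OF acm]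
  have xv: "\<xi> \<in> vector_fields A" using acm by (auto simp: almost_contact_metric_manifold_def)
  have \<eta>\<xi>: "\<eta> p (\<xi> p) = 1" using acm by (auto simp: almost_contact_metric_manifold_def)
  have comp: "g p (\<phi> p u) (\<phi> p v) = g p u v - \<eta> p u * \<eta> p v"
    if "u \<in> tangent_space A p" "v \<in> tangent_space A p" for u v
    using acm that by (auto simp: almost_contact_metric_manifold_def)
  let ?N = "nabla X \<xi> p"
  have Xp: "X p \<in> tangent_space A p" using X by (auto simp: vector_fields_def)
  have "nabla X \<xi> \<in> vector_fields A" using aff X xv by (auto simp: affine_connection_def)
  then have N: "?N \<in> tangent_space A p" by (auto simp: vector_fields_def)
  have z: "(0::'a vfield) \<in> vector_fields A"
    using tangent_closed(1) by (auto simp: vector_fields_def smooth_functions_const)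
  have "nabla X (0 + 0) = nabla X 0 + nabla X 0"
    using aff X z unfolding affine_connection_def by blast
  then have n0: "nabla X 0 = 0" by simp
  have "(\<lambda>q. \<phi> q (\<xi> q)) = 0" using acm_algebra(2)[OF acm] by (simp add: fun_eq_iff)
  moreover have "g p (\<phi> p (X p)) (\<xi> p) = 0" using al(3,4,5) Xp by metis
  ultimately have "- \<phi> p ?N = \<alpha> \<odot> (- \<phi> p (X p))"
    using ken[rule_format, OF X xv, of p] n0 \<eta>\<xi> by simp
  then have "\<phi> p ?N = \<alpha> \<odot> \<phi> p (X p)" by (metis minus_equation_iff tv.scale_minus_right)
  then have "g p (\<phi> p ?N) (\<phi> p (X p)) = \<alpha> * g p (\<phi> p (X p)) (\<phi> p (X p))"
    using g_scale[OF al(5)[OF Xp] al(5)[OF Xp]] by simp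
  then show ?thesis using comp[OF N Xp] comp[OF Xp Xp] h by simp
qed

section \<open>Nonexistence of contact-complex Riemannian submersions\<close>

theorem mainTheorem13:
  fixes \<alpha> :: real
    and A :: "('m::{second_countable_topology, t2_space}, 'e::euclidean_space) atlas"
    and \<phi> :: "'m \<Rightarrow> 'm tvec \<Rightarrow> 'm tvec"
    and \<xi> :: "'m vfield"
    and \<eta> :: "'m \<Rightarrow> 'm tvec \<Rightarrow> real"
    and g :: "'m \<Rightarrow> 'm tvec \<Rightarrow> 'm tvec \<Rightarrow> real"
    and m n :: nat
  assumes "\<alpha> \<noteq> 0"
    and "alpha_kenmotsu_manifold \<alpha> A \<phi> \<xi> \<eta> g"
    and "DIM('e) = 2 * m + 1" and "2 * m + 1 \<ge> 5"
    and "DIM('d) = 2 * n" and "2 * n \<ge> 2"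
  shows "\<not> (\<exists>(B :: ('n::{second_countable_topology, t2_space}, 'd::euclidean_space) atlas) J g' \<pi>.
            almost_hermitian_manifold B J g' \<and>
            contact_complex_riemannian_submersion A \<phi> \<xi> \<eta> g B J g' \<pi>)"
proof
  assume "\<exists>(B :: ('n, 'd) atlas) J g' \<pi>. almost_hermitian_manifold B J g' \<and>
    contact_complex_riemannian_submersion A \<phi> \<xi> \<eta> g B J g' \<pi>"
  then obtain B :: "('n, 'd) atlas" and J g' \<pi> where
    her: "almost_hermitian_manifold B J g'" and
    sub: "contact_complex_riemannian_submersion A \<phi> \<xi> \<eta> g B J g' \<pi>" by blast
  from assms(2) obtain nabla where
    acm: "almost_contact_metric_manifold A \<phi> \<xi> \<eta> g" and lc: "levi_civita_connection A g nabla" and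
    ken: "\<forall>X\<in>vector_fields A. \<forall>Y\<in>vector_fields A. \<forall>p.
          nabla X (\<lambda>q. \<phi> q (Y q)) p - \<phi> p (nabla X Y p) =
          \<alpha> \<odot> (g p (\<phi> p (X p)) (Y p) \<odot> \<xi> p - \<eta> p (Y p) \<odot> \<phi> p (X p))"
    unfolding alpha_kenmotsu_manifold_def by blast
  have aff: "affine_connection A nabla" using lc by (simp add: levi_civita_connection_def)
  have TA: "tangent_metric A g" by (rule acm_algebra(6)[OF acm])
  have TB: "tangent_metric B g'"
    using her by (auto simp: almost_hermitian_manifold_def tangent_metric_def)
  have rs: "riemannian_submersion A g B g' \<pi>"
    using sub by (simp add: contact_complex_riemannian_submersion_def)
  interpret submersion A g B g' \<pi>
    by (intro submersion.intro TA TB submersion_axioms.intro rs)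
  have sm: "smooth_map A B \<pi>" using rs by (simp add: riemannian_submersion_def)
  note pull = smooth_functions_pullback[OF A.M B.M sm]
  have xv: "\<xi> \<in> vector_fields A" using acm by (auto simp: almost_contact_metric_manifold_def)
  note xi = acm_algebra(1)[OF acm]

  \<comment> \<open>\<open>\<xi>\<close> is vertical, since \<open>J (d\<pi> \<xi>) = d\<pi> (\<phi> \<xi>) = 0\<close> and \<open>J\<close> is invertible.\<close>
  have D\<xi>: "D (\<xi> q) = 0" for q
  proof -
    have "J (\<pi> q) (D (\<xi> q)) = D (\<phi> q (\<xi> q))"
      using sub xi by (simp add: contact_complex_riemannian_submersion_def)
    then have "J (\<pi> q) (D (\<xi> q)) = 0" by (simp add: acm_algebra(2)[OF acm] differential_simps)
    moreover have "J (\<pi> q) (J (\<pi> q) (D (\<xi> q))) = - D (\<xi> q)"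
      using her D_tangent[OF xi] by (simp add: almost_hermitian_manifold_def)
    moreover have "J (\<pi> q) 0 = 0"
    proof -
      have "J (\<pi> q) (0 \<odot> 0 + 0 \<odot> 0) = 0 \<odot> J (\<pi> q) 0 + 0 \<odot> J (\<pi> q) 0"
        using her B.tangent_closed(1) unfolding almost_hermitian_manifold_def tensor_11_def by blast
      then show ?thesis by simp
    qed
    ultimately show ?thesis by simp
  qed
  have \<xi>pull: "\<xi> q (k \<circ> \<pi>) = 0" if "k \<in> smooth_functions B" for q k
    using fun_cong[OF D\<xi>[of q], of k] that by (simp add: differential_def)

  define p :: 'm where "p = undefined"
  obtain W' and k :: "'d \<Rightarrow> 'n \<Rightarrow> real" and E where W': "open W'" "\<pi> p \<in> W'"
    and k: "\<And>i. k i \<in> smooth_functions B" and E: "\<And>i. E i \<in> vector_fields B"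
    and Erep: "\<And>q w f. q \<in> W' \<Longrightarrow> w \<in> tangent_space B q \<Longrightarrow> w f = (\<Sum>i\<in>Basis. w (k i) * E i q f)"
    and Edual: "\<And>i q. i \<in> Basis \<Longrightarrow> q \<in> W' \<Longrightarrow> E i q (k i) = 1"
    by (rule local_frame[OF B.M, of "\<pi> p"]) blast
  have ET: "E i q \<in> tangent_space B q" for i q using E[of i] by (simp add: vector_fields_def)

  obtain X where X: "X \<in> vector_fields A" and XH: "X p \<in> horizontal_space A g B \<pi> p" and X0: "X p \<noteq> 0"
  proof -
    obtain i :: 'd where i: "i \<in> Basis" using nonempty_Basis by blast
    have "D ` tangent_space A p = tangent_space B (\<pi> p)" using rs by (simp add: riemannian_submersion_def)
    then obtain u where u: "u \<in> tangent_space A p" "D u = E i (\<pi> p)" using ET[of i "\<pi> p"] by force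
    obtain v where v: "v \<in> horizontal_space A g B \<pi> p" "D v = D u" using horizontal_part[OF u(1)] by metis
    have "v \<in> tangent_space A p" using v by (simp add: horizontal_space_def)
    then obtain X where "X \<in> vector_fields A" "X p = v" by (rule tangent_extend[OF A.M])
    moreover have "v \<noteq> 0" using Edual[OF i W'(2)] v(2) u(2) by (auto simp: differential_simps)
    ultimately show thesis using that v(1) by blast
  qed
  have XT: "X q \<in> tangent_space A q" for q using X by (simp add: vector_fields_def)

  define a where "a = (\<lambda>i q. X q (k i \<circ> \<pi>))"
  define G where "G = (\<lambda>i j q. g' q (E i q) (E j q))"
  have as: "a i \<in> smooth_functions A" for i
    using X pull[OF k[of i]] by (simp add: a_def vector_fields_def)
  have Gs: "G i j \<in> smooth_functions B" for i j
    using B.R E[of i] E[of j] by (simp add: riemannian_metric_def G_def)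
  have pulled: "g' (\<pi> q) (D u) (D v) =
      (\<Sum>i\<in>Basis. \<Sum>j\<in>Basis. u (k i \<circ> \<pi>) * v (k j \<circ> \<pi>) * G i j (\<pi> q))"
    if q: "\<pi> q \<in> W'" and uv: "u \<in> tangent_space A q" "v \<in> tangent_space A q" for q u v
    unfolding G_def
    using B.g_frame[OF ET D_tangent[OF uv(1)] Erep[OF q D_tangent[OF uv(1)]]
        D_tangent[OF uv(2)] Erep[OF q D_tangent[OF uv(2)]]] k
    by (simp add: differential_def)

  \<comment> \<open>Over \<open>W'\<close> this is \<open>g(X, X) - g'(d\<pi> X, d\<pi> X)\<close>, written so that it is smooth everywhere.\<close>
  define F where "F = (\<lambda>q. g q (X q) (X q) - (\<Sum>i\<in>Basis. \<Sum>j\<in>Basis. (a i q * a j q) * (G i j \<circ> \<pi>) q))"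
  have gX: "(\<lambda>q. g q (X q) (X q)) \<in> smooth_functions A"
    using A.R X by (simp add: riemannian_metric_def)
  note s2 = smooth_functions_mult[OF A.M smooth_functions_mult[OF A.M as as] pull[OF Gs]]
  note s1 = smooth_functions_sum[OF A.M s2]
  note s0 = smooth_functions_sum[OF A.M s1]
  have Fs: "F \<in> smooth_functions A" unfolding F_def by (rule smooth_functions_diff[OF A.M gX s0])
  have F: "F q = g q (X q) (X q) - g' (\<pi> q) (D (X q)) (D (X q))" if "\<pi> q \<in> W'" for q
    using pulled[OF that XT XT] by (simp add: F_def a_def)
  have "\<xi> p F = 0"
  proof -
    obtain W and h :: "'e \<Rightarrow> 'm \<Rightarrow> real" and Y where "p \<in> W" and
      Yrep: "\<And>q w f. q \<in> W \<Longrightarrow> w \<in> tangent_space A q \<Longrightarrow> w f = (\<Sum>i\<in>Basis. w (h i) * Y i q f)" and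
      Ymin: "\<And>i f N. f \<in> smooth_functions A \<Longrightarrow> open N \<Longrightarrow> p \<in> N \<Longrightarrow>
        (\<And>q. q \<in> N \<Longrightarrow> f p \<le> f q) \<Longrightarrow> Y i p f = 0"
      by (rule local_frame[OF A.M, of p]) blast
    have "Y i p F = 0" for i
    proof (rule Ymin[OF Fs, of "\<pi> -` W'"])
      show "open (\<pi> -` W')" using sm W'(1) open_vimage by (auto simp: smooth_map_def)
      show "p \<in> \<pi> -` W'" using W' by simp
      have "F p = 0" using F[OF W'(2)] g_horizontal[OF XT XH] by simp
      then show "F p \<le> F q" if "q \<in> \<pi> -` W'" for q
        using F[of q] that g_contracts[OF XT[of q]] by simp
    qed
    then show ?thesis using Yrep[OF \<open>p \<in> W\<close> xi, of F] by simp
  qed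

  define Z where "Z = lie_bracket \<xi> X p"
  let ?N = "nabla X \<xi> p"
  have nv: "nabla \<xi> X \<in> vector_fields A" "nabla X \<xi> \<in> vector_fields A"
    using aff X xv by (auto simp: affine_connection_def)
  then have NT: "nabla \<xi> X p \<in> tangent_space A p" "?N \<in> tangent_space A p"
    by (auto simp: vector_fields_def)
  have "nabla \<xi> X - nabla X \<xi> = lie_bracket \<xi> X"
    using lc X xv by (simp add: levi_civita_connection_def)
  then have Z: "Z = nabla \<xi> X p - ?N" unfolding Z_def by (metis fun_diff_def)
  have ZT: "Z \<in> tangent_space A p" unfolding Z by (rule A.tangent_closed(3)[OF NT])
  \<comment> \<open>In the bracket the term \<open>X (\<xi> (k i \<circ> \<pi>))\<close> vanishes.\<close>
  have Za: "\<xi> p (a i) = Z (k i \<circ> \<pi>)" for i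
    using tangent_const[OF XT, of p 0] by (simp add: Z_def lie_bracket_def a_def \<xi>pull[OF k])

  have "\<xi> p (\<lambda>q. (a i q * a j q) * (G i j \<circ> \<pi>) q) =
      a i p * Z (k j \<circ> \<pi>) * G i j (\<pi> p) + Z (k i \<circ> \<pi>) * a j p * G i j (\<pi> p)" for i j
    using tangent_spaceD(3)[OF xi smooth_functions_mult[OF A.M as as] pull[OF Gs], of p i j i j]
      tangent_spaceD(3)[OF xi as as, of p i j] \<xi>pull[OF Gs] Za
    by (simp add: algebra_simps)
  then have "\<xi> p F = \<xi> p (\<lambda>q. g q (X q) (X q)) -
      (g' (\<pi> p) (D (X p)) (D Z) + g' (\<pi> p) (D Z) (D (X p)))"
    unfolding F_def
    by (simp only: tangent_diff[OF A.M xi gX s0] tangent_sum[OF A.M xi s1] tangent_sum[OF A.M xi s2]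
        pulled[OF W'(2) XT ZT] pulled[OF W'(2) ZT XT] sum.distrib) (simp add: a_def)
  also have "g' (\<pi> p) (D (X p)) (D Z) = g' (\<pi> p) (D Z) (D (X p))"
    by (rule B.g_sym[OF D_tangent[OF XT] D_tangent[OF ZT]])
  also have "g' (\<pi> p) (D Z) (D (X p)) = g p Z (X p)" by (rule g_horizontal[OF ZT XH])
  also have "\<xi> p (\<lambda>q. g q (X q) (X q)) = 2 * g p (nabla \<xi> X p) (X p)"
  proof -
    have "\<xi> p (\<lambda>q. g q (X q) (X q)) = g p (nabla \<xi> X p) (X p) + g p (X p) (nabla \<xi> X p)"
      using lc X xv unfolding levi_civita_connection_def by blast
    then show ?thesis using A.g_sym[OF NT(1) XT] by simp
  qed
  also have "g p Z (X p) = g p (nabla \<xi> X p) (X p) - g p ?N (X p)"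
    unfolding Z by (rule A.g_diff[OF NT XT])
  finally have "g p ?N (X p) = 0" using \<open>\<xi> p F = 0\<close> by simp
  moreover have "g p ?N (X p) = \<alpha> * g p (X p) (X p)"
  proof (rule kenmotsu_nabla_xi[OF acm aff ken X])
    have "\<xi> p \<in> vertical_space A B \<pi> p" using xi D\<xi> by (simp add: vertical_space_def)
    then show "\<eta> p (X p) = 0"
      using XH acm_algebra(3)[OF acm XT] by (simp add: horizontal_space_def)
  qed
  ultimately show False using assms(1) A.g_pos[OF XT X0] by simp
qed

end
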